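(* Let $n\ge 1$ and let $u:\mathbb{R}^n\to\mathbb{R}$ be a non-constant classical solution of $-\Delta u=u-u^3$ in $\mathbb{R}^n$. Let $H(t)=\tanh(t/\sqrt{2})$. If $u<0$ in the half-space $\{x\in\mathbb{R}^n:x_n<0\}$, then there exists $a\in\mathbb{R}$ such that $$u(x)\le H(x_n+a)\quad\text{for all }x\in\mathbb{R}^n,$$ and either (1) $u(x)=H(x_n+a)$ for all $x\in\mathbb{R}^n$, or (2) $u(x)<H(x_n+a)$ for all $x\in\mathbb{R}^n$ and there exists a sequence $(y_k)_{k\in\mathbb{N}}$ in $\mathbb{R}^{n-1}\times\{0\}$ such that $|y_k|\to+\infty$ as $k\to+\infty$ and the functions $u(\cdot+y_k)$ converge in $C^2_{loc}(\mathbb{R}^n)$ to the function $x\mapsto H(x_n+a)$ as $k\to+\infty$.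
   Context: Points of $\mathbb{R}^n$ are written $x=(x_1,\dots,x_n)$, and $|\cdot|$ is the Euclidean norm. Solutions are real-valued and understood in the classical ($C^2$) sense on all of $\mathbb{R}^n$. Convergence in $C^2_{loc}(\mathbb{R}^n)$ means uniform convergence on compact sets of the functions and of their partial derivatives up to order $2$. *)

theory Defs
  imports "HOL-Analysis.Analysis"
begin

definition partial_deriv :: "'n \<Rightarrow> (real ^ 'n \<Rightarrow> real) \<Rightarrow> real ^ 'n \<Rightarrow> real" where
  "partial_deriv i f x = frechet_derivative f (at x) (axis i 1)"

definition C1 :: "(real ^ 'n \<Rightarrow> real) \<Rightarrow> bool" where
  "C1 f \<longleftrightarrow> f differentiable_on UNIV \<and> (\<forall>i. continuous_on UNIV (partial_deriv i f))"

definition C2 :: "(real ^ 'n \<Rightarrow> real) \<Rightarrow> bool" where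
  "C2 f \<longleftrightarrow> C1 f \<and> (\<forall>i. C1 (partial_deriv i f))"

definition laplacian :: "(real ^ 'n \<Rightarrow> real) \<Rightarrow> real ^ 'n \<Rightarrow> real" where
  "laplacian f x = (\<Sum>i\<in>UNIV. partial_deriv i (partial_deriv i f) x)"

definition classical_solution :: "(real ^ 'n \<Rightarrow> real) \<Rightarrow> bool" where
  "classical_solution u \<longleftrightarrow> C2 u \<and> (\<forall>x. - laplacian u x = u x - u x ^ 3)"

definition H :: "real \<Rightarrow> real" where
  "H t = tanh (t / sqrt 2)"

(* Partial derivatives are total functions with unspecified values where f is not
   differentiable, so this is meaningful only for C2 functions. *)
definition converges_C2_loc ::
    "(nat \<Rightarrow> real ^ 'n \<Rightarrow> real) \<Rightarrow> (real ^ 'n \<Rightarrow> real) \<Rightarrow> bool" where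
  "converges_C2_loc f g \<longleftrightarrow> (\<forall>K. compact K \<longrightarrow>
     uniform_limit K f g sequentially \<and>
     (\<forall>i. uniform_limit K (\<lambda>k. partial_deriv i (f k)) (partial_deriv i g) sequentially) \<and>
     (\<forall>i j. uniform_limit K (\<lambda>k. partial_deriv i (partial_deriv j (f k)))
               (partial_deriv i (partial_deriv j g)) sequentially))"

end

theory Submission
  imports Defs
begin

text \<open>
  Everything is deduced from one fact: at a local maximum of a difference, the second derivatives
  along the axes are ordered. Suitable comparison functions give \<open>\<bar>u\<bar> \<le> 1\<close> (Keller--Osserman),
  \<open>u \<le> -3/4\<close> deep inside the half-space, interior estimates of first and second derivatives, and
  a lower bound for nonnegative supersolutions that serves as strong maximum principle and,
  combined with the gradient bound, as Harnack inequality. Since \<open>s\<^sup>3 - s\<close> is increasing where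
  \<open>\<bar>s\<bar> \<ge> 3/4\<close>, the comparison \<open>u \<le> H(x\<^sub>n + b)\<close> only has to be checked where \<open>H(x\<^sub>n + b)\<close> is not
  close to 1 and \<open>u\<close> is not close to -1; this yields it for large \<open>b\<close>. Let \<open>a\<close> be the infimum of all
  such \<open>b\<close>. If \<open>u\<close> does not touch \<open>H(x\<^sub>n + a)\<close>, then by minimality the gap tends to 0 along points of
  a slab. As the limit profile is known, the Harnack inequality applied to the gap replaces
  compactness arguments, and the derivative estimates upgrade the convergence to second order.
\<close>

subsection \<open>Comparison at a local maximum\<close>

text \<open>If \<open>d\<close> were positive, \<open>g'\<close> would be positive just to the right
  of its zero at 0, and by the mean value theorem \<open>g\<close> would rise above
  \<open>g 0\<close> there.\<close>

lemma second_deriv_nonpos_at_max: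
  fixes g g' :: "real \<Rightarrow> real"
  assumes e: "0 < e"
    and g: "\<And>t. \<bar>t\<bar> < e \<Longrightarrow> (g has_real_derivative g' t) (at t)"
    and g': "(g' has_real_derivative d) (at 0)"
    and mx: "\<And>t. \<bar>t\<bar> < e \<Longrightarrow> g t \<le> g 0"
  shows "d \<le> 0"
proof (rule ccontr)
  assume "\<not> d \<le> 0"
  then obtain b where b: "0 < b" "\<And>h. 0 < h \<Longrightarrow> h < b \<Longrightarrow> g' 0 < g' (0 + h)"
    using DERIV_pos_inc_right[OF g'] by force
  have "g' 0 = 0"
    using DERIV_local_max[OF g[of 0], of e] e mx by auto
  define t where "t = min b e / 2"
  have t: "0 < t" "t < b" "t < e" using b e by (auto simp: t_def)
  have "\<exists>z. 0 < z \<and> z < t \<and> g t - g 0 = (t - 0) * g' z"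
    by (rule MVT2) (use t g in auto)
  then obtain z where z: "0 < z" "z < t" "g t - g 0 = t * g' z" by auto
  have "g' z > 0" using b(2)[of z] z t \<open>g' 0 = 0\<close> by auto
  then have "g t - g 0 > 0" using z t by simp
  moreover have "g t \<le> g 0" using mx[of t] t by auto
  ultimately show False by simp
qed

text \<open>\<open>p i\<close> and \<open>q i\<close> are the first and the pure second derivative
  along axis \<open>i\<close>, so the sum of the \<open>q i\<close> is the Laplacian. Asking only
  for derivatives along coordinate lines, besides continuity, keeps the class visibly closed under
  differences, multiples, translations and reflections, hence under difference quotients.\<close>

definition axis_derivs ::
    "(real^'n \<Rightarrow> real) \<Rightarrow> ('n \<Rightarrow> real^'n \<Rightarrow> real) \<Rightarrow> ('n \<Rightarrow> real^'n \<Rightarrow> real) \<Rightarrow> bool" where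
  "axis_derivs w p q \<longleftrightarrow> continuous_on UNIV w \<and>
     (\<forall>i x t. ((\<lambda>t. w (x + t *\<^sub>R axis i 1)) has_real_derivative p i (x + t *\<^sub>R axis i 1)) (at t) \<and>
              ((\<lambda>t. p i (x + t *\<^sub>R axis i 1)) has_real_derivative q i (x + t *\<^sub>R axis i 1)) (at t))"

lemma axis_derivsD:
  assumes "axis_derivs w p q"
  shows "continuous_on S w"
    "((\<lambda>t. w (x + t *\<^sub>R axis i 1)) has_real_derivative p i (x + t *\<^sub>R axis i 1)) (at t)"
    "((\<lambda>t. p i (x + t *\<^sub>R axis i 1)) has_real_derivative q i (x + t *\<^sub>R axis i 1)) (at t)"
  using assms unfolding axis_derivs_def by (auto intro: continuous_on_subset)

lemma axis_derivs_diff: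
  assumes "axis_derivs w p q" "axis_derivs w' p' q'"
  shows "axis_derivs (\<lambda>x. w x - w' x) (\<lambda>i x. p i x - p' i x) (\<lambda>i x. q i x - q' i x)"
  using assms unfolding axis_derivs_def
  by (auto intro!: continuous_on_diff DERIV_diff)

lemma axis_derivs_uminus:
  assumes "axis_derivs w p q"
  shows "axis_derivs (\<lambda>x. - w x) (\<lambda>i x. - p i x) (\<lambda>i x. - q i x)"
  using assms unfolding axis_derivs_def
  by (auto intro!: continuous_on_minus DERIV_minus)

lemma axis_derivs_cmult:
  assumes "axis_derivs w p q"
  shows "axis_derivs (\<lambda>x. c * w x) (\<lambda>i x. c * p i x) (\<lambda>i x. c * q i x)"
  using assms unfolding axis_derivs_def
  by (auto intro!: continuous_on_mult_left DERIV_cmult)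

lemma axis_derivs_translate:
  assumes "axis_derivs w p q"
  shows "axis_derivs (\<lambda>x. w (c + x)) (\<lambda>i x. p i (c + x)) (\<lambda>i x. q i (c + x))"
proof -
  have "continuous_on UNIV (\<lambda>x. w (c + x))"
    using assms unfolding axis_derivs_def
    by (auto intro!: continuous_on_compose2[of UNIV w] continuous_intros)
  then show ?thesis using assms unfolding axis_derivs_def
    by (auto simp: add.assoc[symmetric])
qed

text \<open>At a maximum of \<open>w - g\<close> along one coordinate line the second derivatives
  are ordered. All comparison arguments below reduce to this.\<close>

lemma axis_touch:
  fixes x :: "real^'n"
  assumes w: "axis_derivs w p q" and e: "0 < e"
    and g: "\<And>t. \<bar>t\<bar> < e \<Longrightarrow> (g has_real_derivative g' t) (at t)"
    and g': "(g' has_real_derivative d) (at 0)"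
    and mx: "\<And>t. \<bar>t\<bar> < e \<Longrightarrow> w (x + t *\<^sub>R axis i 1) - g t \<le> w x - g 0"
  shows "q i x \<le> d"
proof -
  have "q i x - d \<le> 0"
  proof (rule second_deriv_nonpos_at_max[OF e])
    show "((\<lambda>t. w (x + t *\<^sub>R axis i 1) - g t) has_real_derivative
            p i (x + t *\<^sub>R axis i 1) - g' t) (at t)" if "\<bar>t\<bar> < e" for t
      using axis_derivsD(2)[OF w] g[OF that] by (intro DERIV_diff) auto
    show "((\<lambda>t. p i (x + t *\<^sub>R axis i 1) - g' t) has_real_derivative q i x - d) (at 0)"
      using axis_derivsD(3)[OF w, where x = x and i = i and t = 0] g' by (intro DERIV_diff) auto
  qed (use mx in auto)
  then show ?thesis by simp
qed

lemma norm_add_axis_sq: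
  fixes y :: "real^'n"
  shows "(norm (y + t *\<^sub>R axis i 1))\<^sup>2 = (norm y)\<^sup>2 + 2 * t * y $ i + t\<^sup>2"
proof -
  have "y \<bullet> axis i 1 = y $ i" by (simp add: inner_axis)
  then show ?thesis
    unfolding power2_norm_eq_inner
    by (simp add: inner_add_left inner_add_right inner_commute power2_eq_square algebra_simps)
qed

lemma norm_sq_cart: "(norm (y::real^'n))\<^sup>2 = (\<Sum>i\<in>UNIV. (y $ i)\<^sup>2)"
  by (simp add: norm_vec_def L2_set_def sum_nonneg)

text \<open>The bound is the Laplacian at \<open>x\<close> of the test function \<open>F\<close> of
  the squared distance to \<open>z\<close>, where \<open>d\<close> stands for the second derivative
  of \<open>F\<close>. It results from summing \<open>axis_touch\<close> over all axes.\<close>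

lemma radial_touch:
  fixes x z :: "real^'n" and F F' :: "real \<Rightarrow> real"
  assumes w: "axis_derivs w p q" and S: "open S" "x \<in> S"
    and mx: "\<And>y. y \<in> S \<Longrightarrow> w y - F ((norm (y - z))\<^sup>2) \<le> w x - F ((norm (x - z))\<^sup>2)"
    and F: "\<And>y. y \<in> S \<Longrightarrow> (F has_real_derivative F' ((norm (y - z))\<^sup>2)) (at ((norm (y - z))\<^sup>2))"
    and F': "(F' has_real_derivative d) (at ((norm (x - z))\<^sup>2))"
  shows "(\<Sum>i\<in>UNIV. q i x) \<le> 4 * (norm (x - z))\<^sup>2 * d + 2 * real CARD('n) * F' ((norm (x - z))\<^sup>2)"
proof -
  obtain e where e: "0 < e" "ball x e \<subseteq> S" using S by (meson openE)
  have line: "x + t *\<^sub>R axis i 1 \<in> S" if "\<bar>t\<bar> < e" for t and i :: 'n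
    using that e by (auto simp: subset_iff dist_norm norm_axis_1)
  define s where "s = (\<lambda>i t. (norm (x - z))\<^sup>2 + 2 * t * (x - z) $ i + t\<^sup>2)"
  have s: "(norm (x + t *\<^sub>R axis i 1 - z))\<^sup>2 = s i t" for i t
    unfolding s_def norm_add_axis_sq[symmetric] by (simp add: algebra_simps)
  have s0: "s i 0 = (norm (x - z))\<^sup>2" for i by (simp add: s_def)
  have ds: "(s i has_real_derivative 2 * (x - z) $ i + 2 * t) (at t)" for i t
    unfolding s_def by (auto intro!: derivative_eq_intros)
  have "q i x \<le> 4 * ((x - z) $ i)\<^sup>2 * d + 2 * F' ((norm (x - z))\<^sup>2)" for i
  proof (rule axis_touch[OF w e(1), where g = "\<lambda>t. F (s i t)"
        and g' = "\<lambda>t. F' (s i t) * (2 * (x - z) $ i + 2 * t)"])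
    fix t :: real assume t: "\<bar>t\<bar> < e"
    show "((\<lambda>t. F (s i t)) has_real_derivative F' (s i t) * (2 * (x - z) $ i + 2 * t)) (at t)"
      by (rule DERIV_chain2[OF _ ds]) (use F[OF line[OF t, of i]] in \<open>simp add: s\<close>)
    show "w (x + t *\<^sub>R axis i 1) - F (s i t) \<le> w x - F (s i 0)"
      using mx[OF line[OF t, of i]] by (simp add: s s0)
  next
    have "((\<lambda>t. F' (s i t)) has_real_derivative d * (2 * (x - z) $ i + 2 * 0)) (at 0)"
      by (rule DERIV_chain2[OF _ ds]) (use F' in \<open>simp add: s0\<close>)
    moreover have "((\<lambda>t. 2 * (x - z) $ i + 2 * t) has_real_derivative 2) (at 0)"
      by (auto intro!: derivative_eq_intros)
    ultimately show "((\<lambda>t. F' (s i t) * (2 * (x - z) $ i + 2 * t)) has_real_derivative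
        4 * ((x - z) $ i)\<^sup>2 * d + 2 * F' ((norm (x - z))\<^sup>2)) (at 0)"
      by (rule DERIV_cong[OF DERIV_mult]) (simp add: s0 power2_eq_square algebra_simps)
  qed
  then have "(\<Sum>i\<in>UNIV. q i x) \<le> (\<Sum>i\<in>UNIV. 4 * ((x - z) $ i)\<^sup>2 * d + 2 * F' ((norm (x - z))\<^sup>2))"
    by (rule sum_mono)
  also have "\<dots> = 4 * (norm (x - z))\<^sup>2 * d + 2 * real CARD('n) * F' ((norm (x - z))\<^sup>2)"
    by (simp add: norm_sq_cart sum.distrib sum_distrib_left sum_distrib_right del: vector_minus_component)
  finally show ?thesis .
qed

subsection \<open>Maximum principles\<close>

lemma compact_attains_max:
  fixes f :: "'a::topological_space \<Rightarrow> real"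
  assumes "compact S" "x \<in> S" "continuous_on S f"
  obtains y where "y \<in> S" "\<And>z. z \<in> S \<Longrightarrow> f z \<le> f y" "f x \<le> f y"
  using continuous_attains_sup[of S f] assms by blast

text \<open>
  Maximising \<open>(u - 1) (R\<^sup>2 - r\<^sup>2)\<close> amounts to touching \<open>u\<close> from above by \<open>1 + m / (R\<^sup>2 - r\<^sup>2)\<close>,
  which blows up on the sphere of radius \<open>R\<close>.
\<close>

lemma le_1_if_laplacian_eq:
  fixes u :: "real^'n \<Rightarrow> real"
  assumes u: "axis_derivs u p q" and eq: "\<And>x. (\<Sum>i\<in>UNIV. q i x) = u x ^ 3 - u x"
  shows "u z \<le> 1"
proof (rule ccontr)
  assume "\<not> u z \<le> 1"
  then have v0: "0 < u z - 1" by simp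
  let ?n = "real CARD('n)"
  \<comment> \<open>This gives \<open>(u z - 1)\<^sup>2 * R\<^sup>2\<close> the value 9 + 2n, just
    above the constant 8 + 2n that the touching argument allows.\<close>
  define R where "R = sqrt (9 + 2 * ?n) / (u z - 1)"
  have R: "R > 0" unfolding R_def using v0 by (auto intro!: divide_pos_pos)
  have R2: "(u z - 1)\<^sup>2 * R\<^sup>2 = 9 + 2 * ?n" unfolding R_def using v0
    by (simp add: power_divide)
  let ?r = "\<lambda>y. (norm (y - z))\<^sup>2"
  let ?P = "\<lambda>y. (u y - 1) * (R\<^sup>2 - ?r y)"
  have "continuous_on (cball z R) ?P"
    by (intro continuous_intros axis_derivsD(1)[OF u])
  then obtain x where x: "x \<in> cball z R" "\<And>y. y \<in> cball z R \<Longrightarrow> ?P y \<le> ?P x" "?P z \<le> ?P x"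
    using compact_attains_max[of "cball z R" z ?P] R by auto
  define m where "m = ?P x"
  have m: "m \<ge> (u z - 1) * R\<^sup>2" using x(3) by (simp add: m_def)
  have m0: "m > 0" using m v0 R by (smt (verit) mult_pos_pos zero_less_power)
  have rle: "?r x \<le> R\<^sup>2" using x(1) R
    by (intro power_mono) (auto simp: dist_norm norm_minus_commute)
  define \<eta> where "\<eta> = R\<^sup>2 - ?r x"
  have \<eta>: "\<eta> > 0" using m0 rle unfolding m_def \<eta>_def by (smt (verit) mult_eq_0_iff)
  have inS: "?r y < R\<^sup>2" if "y \<in> ball z R" for y
    using that R by (intro power_strict_mono) (auto simp: dist_norm norm_minus_commute)
  have xS: "x \<in> ball z R"
    using \<eta> R power2_less_imp_less[of "norm (x - z)" R] unfolding \<eta>_def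
    by (auto simp: dist_norm norm_minus_commute)
  have vx: "u x - 1 = m / \<eta>" using \<eta> by (simp add: m_def \<eta>_def)
  have "(\<Sum>i\<in>UNIV. q i x) \<le> 4 * ?r x * (2 * m / (R\<^sup>2 - ?r x)^3) + 2 * ?n * (m / (R\<^sup>2 - ?r x)\<^sup>2)"
  proof (rule radial_touch[OF u open_ball xS, where F = "\<lambda>s. m / (R\<^sup>2 - s)"])
    fix y assume y: "y \<in> ball z R"
    have "?P y \<le> m" using x(2)[of y] y by (auto simp: m_def)
    then have "u y - 1 \<le> m / (R\<^sup>2 - ?r y)" using inS[OF y] by (simp add: pos_le_divide_eq)
    then show "u y - m / (R\<^sup>2 - ?r y) \<le> u x - m / (R\<^sup>2 - ?r x)"
      using vx by (simp add: \<eta>_def)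
    show "((\<lambda>s. m / (R\<^sup>2 - s)) has_real_derivative m / (R\<^sup>2 - ?r y)\<^sup>2) (at (?r y))"
      using inS[OF y] by (auto intro!: derivative_eq_intros simp: power2_eq_square)
  next
    show "((\<lambda>s. m / (R\<^sup>2 - s)\<^sup>2) has_real_derivative 2 * m / (R\<^sup>2 - ?r x)^3) (at (?r x))"
    proof (rule DERIV_cong)
      show "((\<lambda>s. m / (R\<^sup>2 - s)\<^sup>2) has_real_derivative m * (2 * \<eta>) / (\<eta>\<^sup>2 * \<eta>\<^sup>2)) (at (?r x))"
        using \<eta> unfolding \<eta>_def
        by (auto intro!: derivative_eq_intros simp: minus_divide_left right_diff_distrib)
      show "m * (2 * \<eta>) / (\<eta>\<^sup>2 * \<eta>\<^sup>2) = 2 * m / (R\<^sup>2 - ?r x)^3"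
        using \<eta> unfolding \<eta>_def[symmetric] by (simp add: field_simps eval_nat_numeral)
    qed
  qed
  also have "\<dots> = (8 * ?r x + 2 * ?n * \<eta>) * m / \<eta>^3"
    using \<eta> unfolding \<eta>_def[symmetric] by (simp add: field_simps eval_nat_numeral)
  finally have 1: "(\<Sum>i\<in>UNIV. q i x) \<le> (8 * ?r x + 2 * ?n * \<eta>) * m / \<eta>^3" .
  \<comment> \<open>The cubic growth of the nonlinearity above 1 is what beats a barrier that is
    infinite on the sphere.\<close>
  have "(u x - 1)^3 \<le> u x ^ 3 - u x"
  proof -
    have "u x - 1 > 0" using vx m0 \<eta> by simp
    then have "0 \<le> (u x - 1) * (3 * (u x - 1) + 2)" by simp
    then show ?thesis by (simp add: eval_nat_numeral algebra_simps)
  qed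
  then have "m^3 / \<eta>^3 \<le> (8 * ?r x + 2 * ?n * \<eta>) * m / \<eta>^3"
    using 1 by (simp add: eq vx power_divide)
  then have "m\<^sup>2 * m \<le> (8 * ?r x + 2 * ?n * \<eta>) * m"
    using \<eta> by (simp add: divide_le_cancel eval_nat_numeral)
  then have "m\<^sup>2 \<le> 8 * ?r x + 2 * ?n * \<eta>" using m0 by simp
  also have "\<dots> \<le> 8 * R\<^sup>2 + 2 * ?n * R\<^sup>2"
    using rle by (intro add_mono mult_left_mono) (auto simp: \<eta>_def)
  also have "\<dots> = (8 + 2 * ?n) * R\<^sup>2" by (simp add: algebra_simps)
  finally have A: "m\<^sup>2 \<le> (8 + 2 * ?n) * R\<^sup>2" .
  have "((u z - 1) * R\<^sup>2)\<^sup>2 \<le> m\<^sup>2" using m v0 by (intro power_mono) auto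
  moreover have "((u z - 1) * R\<^sup>2)\<^sup>2 = (9 + 2 * ?n) * R\<^sup>2"
    unfolding R2[symmetric] by (simp add: power2_eq_square algebra_simps)
  ultimately have "(9 + 2 * ?n) * R\<^sup>2 \<le> (8 + 2 * ?n) * R\<^sup>2" using A by simp
  then show False using R by simp
qed

text \<open>Subtracting a small paraboloid centred at \<open>x\<close> moves the maximum of a
  bounded function into a ball, where its Laplacian is at most that of the paraboloid.\<close>

lemma max_principle_bounded:
  fixes z :: "real^'n \<Rightarrow> real"
  assumes z: "axis_derivs z p q" and bd: "\<And>x. z x \<le> K" and c: "0 < c"
    and sub: "\<And>x. 0 < z x \<Longrightarrow> c * z x \<le> (\<Sum>i\<in>UNIV. q i x)"
  shows "z x \<le> 0"
proof (rule ccontr)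
  assume "\<not> z x \<le> 0"
  then have pos: "0 < z x" by simp
  let ?n = "real CARD('n)"
  \<comment> \<open>With this choice the paraboloid has Laplacian \<open>c * z x / 2\<close>, half
    of what \<open>sub\<close> demands at the maximum.\<close>
  define \<epsilon> where "\<epsilon> = c * z x / (4 * ?n)"
  have \<epsilon>: "\<epsilon> > 0" using c pos by (simp add: \<epsilon>_def)
  \<comment> \<open>At radius \<open>r\<close> the paraboloid exceeds the upper bound
    \<open>K\<close>, so the maximum is not on the sphere.\<close>
  define r where "r = sqrt (K / \<epsilon>) + 1"
  have K: "K > 0" using pos bd[of x] by simp
  have r: "r > 0" "K < \<epsilon> * r\<^sup>2"
  proof -
    show "r > 0" unfolding r_def using K \<epsilon> by (simp add: add_nonneg_pos)
    have "K / \<epsilon> < r\<^sup>2" unfolding r_def power2_sum using K \<epsilon> by (simp add: add_nonneg_pos)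
    then show "K < \<epsilon> * r\<^sup>2" using \<epsilon> by (simp add: field_simps)
  qed
  let ?f = "\<lambda>y. z y - \<epsilon> * (norm (y - x))\<^sup>2"
  have "continuous_on (cball x r) ?f" by (intro continuous_intros axis_derivsD(1)[OF z])
  then obtain y where y: "y \<in> cball x r" "\<And>y'. y' \<in> cball x r \<Longrightarrow> ?f y' \<le> ?f y" "?f x \<le> ?f y"
    using compact_attains_max[of "cball x r" x ?f] r by auto
  have zy: "z x + \<epsilon> * (norm (y - x))\<^sup>2 \<le> z y" using y(3) by simp
  have yb: "y \<in> ball x r"
  proof (rule ccontr)
    assume "y \<notin> ball x r"
    then have "r \<le> norm (y - x)" by (auto simp: dist_norm norm_minus_commute)
    then have "r\<^sup>2 \<le> (norm (y - x))\<^sup>2" using r by (intro power_mono) auto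
    then have "\<epsilon> * r\<^sup>2 \<le> \<epsilon> * (norm (y - x))\<^sup>2" using \<epsilon> by simp
    then show False using zy pos bd[of y] r by linarith
  qed
  have "(\<Sum>i\<in>UNIV. q i y) \<le> 4 * (norm (y - x))\<^sup>2 * 0 + 2 * ?n * \<epsilon>"
    by (rule radial_touch[OF z open_ball yb, where F = "\<lambda>s. \<epsilon> * s" and F' = "\<lambda>s. \<epsilon>"])
      (use y(2) in \<open>auto intro!: derivative_eq_intros\<close>)
  also have "\<dots> = c * z x / 2" by (simp add: \<epsilon>_def)
  also have "\<dots> < c * z x" using c pos by simp
  also have "\<dots> \<le> c * z y" using zy c \<epsilon> by (smt (verit) mult_left_mono mult_nonneg_nonneg zero_le_power2)
  also have "\<dots> \<le> (\<Sum>i\<in>UNIV. q i y)"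
    using sub[of y] zy pos \<epsilon> by (smt (verit) mult_nonneg_nonneg zero_le_power2)
  finally show False by simp
qed

text \<open>Hopf's barrier, an exponential of the negative squared distance to \<open>a\<close>,
  lies below \<open>w\<close>. The constant \<delta> is chosen before \<open>w\<close>,
  \<open>a\<close> and \<open>b\<close>; this uniformity makes a Harnack inequality
  possible.\<close>

lemma supersolution_growth:
  assumes rho: "0 < \<rho>" and R: "0 < R" and m: "0 < m"
  obtains \<delta> where "0 < \<delta>"
    "\<And>(w :: real^'n \<Rightarrow> real) p q a b. axis_derivs w p q \<Longrightarrow> (\<And>x. 0 \<le> w x) \<Longrightarrow>
       (\<And>x. (\<Sum>i\<in>UNIV. q i x) \<le> 2 * w x) \<Longrightarrow> (\<And>x. norm (x - a) \<le> \<rho> \<Longrightarrow> m \<le> w x) \<Longrightarrow>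
       norm (b - a) \<le> R \<Longrightarrow> \<delta> \<le> w b"
proof -
  let ?n = "real CARD('n)"
  \<comment> \<open>Outside radius \<rho> the barrier then satisfies the strict reverse inequality:
    \<alpha> \<ge> 1 and \<open>\<alpha> * \<rho>\<^sup>2\<close> > n + 1 make the factor
    \<open>4 * \<alpha>\<^sup>2 * r\<^sup>2 - 2 * n * \<alpha>\<close> at least 2n + 4, which
    exceeds 2.\<close>
  define \<alpha> where "\<alpha> = 1 + (?n + 1) / \<rho>\<^sup>2"
  have \<alpha>1: "\<alpha> \<ge> 1" unfolding \<alpha>_def by simp
  have \<alpha>2: "\<alpha> * \<rho>\<^sup>2 > ?n + 1" unfolding \<alpha>_def using rho by (simp add: field_simps)
  \<comment> \<open>Subtracting \<open>E\<close> makes the barrier vanish at radius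
    \<open>R + 1\<close>, while it stays positive up to radius \<open>R\<close>.\<close>
  define E where "E = exp (- \<alpha> * (R + 1)\<^sup>2)"
  define \<delta> where "\<delta> = m * (exp (- \<alpha> * R\<^sup>2) - E)"
  show ?thesis
  proof (rule that[of \<delta>])
    have "R\<^sup>2 < (R + 1)\<^sup>2" using R by (intro power_strict_mono) auto
    then show "0 < \<delta>" unfolding \<delta>_def E_def using m \<alpha>1 by (intro mult_pos_pos) auto
  next
    fix w :: "real^'n \<Rightarrow> real" and p q a b
    assume w: "axis_derivs w p q" and w0: "\<And>x. 0 \<le> w x"
      and sup: "\<And>x. (\<Sum>i\<in>UNIV. q i x) \<le> 2 * w x"
      and wm: "\<And>x. norm (x - a) \<le> \<rho> \<Longrightarrow> m \<le> w x" and b: "norm (b - a) \<le> R"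
    let ?r = "\<lambda>y. (norm (y - a))\<^sup>2"
    let ?\<phi> = "\<lambda>y. m * (exp (- \<alpha> * ?r y) - E)"
    let ?f = "\<lambda>y. ?\<phi> y - w y"
    have "continuous_on (cball a (R + 1)) ?f"
      by (intro continuous_intros axis_derivsD(1)[OF w])
    then obtain x where x: "x \<in> cball a (R + 1)"
      "\<And>y. y \<in> cball a (R + 1) \<Longrightarrow> ?f y \<le> ?f x" "?f b \<le> ?f x"
      using compact_attains_max[of "cball a (R + 1)" b ?f] R b
      by (auto simp: dist_norm norm_minus_commute)
    have "?f x \<le> 0"
    proof (rule ccontr)
      assume "\<not> ?f x \<le> 0"
      then have fx: "w x < ?\<phi> x" by simp
      have E0: "E > 0" by (simp add: E_def)
      \<comment> \<open>Inside radius \<rho> the barrier is at most \<open>m\<close>, hence at most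
        \<open>w\<close>.\<close>
      have far: "norm (x - a) > \<rho>"
      proof (rule ccontr)
        assume "\<not> norm (x - a) > \<rho>"
        then have "m \<le> w x" using wm[of x] by simp
        moreover have "exp (- \<alpha> * ?r x) \<le> 1" using \<alpha>1 by simp
        then have "exp (- \<alpha> * ?r x) - E \<le> 1" using E0 by linarith
        then have "?\<phi> x \<le> m * 1" using m by (intro mult_left_mono) auto
        ultimately show False using fx by simp
      qed
      have xb: "x \<in> ball a (R + 1)"
      proof (rule ccontr)
        assume "x \<notin> ball a (R + 1)"
        then have "R + 1 \<le> norm (x - a)" by (auto simp: dist_norm norm_minus_commute)
        then have "(R + 1)\<^sup>2 \<le> ?r x" using R by (intro power_mono) auto
        then have "exp (- \<alpha> * ?r x) \<le> E" unfolding E_def using \<alpha>1 by simp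
        then have "?\<phi> x \<le> 0" using m by (simp add: mult_nonneg_nonpos)
        then show False using fx w0[of x] by simp
      qed
      have "(\<Sum>i\<in>UNIV. - q i x) \<le> 4 * ?r x * (- m * \<alpha>\<^sup>2 * exp (- \<alpha> * ?r x))
          + 2 * ?n * (m * \<alpha> * exp (- \<alpha> * ?r x))"
      proof (rule radial_touch[OF axis_derivs_uminus[OF w] open_ball xb,
            where F = "\<lambda>s. - m * (exp (- \<alpha> * s) - E)"])
        fix y assume "y \<in> ball a (R + 1)"
        then show "- w y - - m * (exp (- \<alpha> * ?r y) - E) \<le> - w x - - m * (exp (- \<alpha> * ?r x) - E)"
          using x(2)[of y] by auto
      qed (auto intro!: derivative_eq_intros simp: power2_eq_square)
      then have "m * exp (- \<alpha> * ?r x) * (4 * \<alpha>\<^sup>2 * ?r x - 2 * ?n * \<alpha>) \<le> (\<Sum>i\<in>UNIV. q i x)"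
        by (simp add: sum_negf algebra_simps)
      also have "\<dots> \<le> 2 * w x" by (rule sup)
      also have "\<dots> < 2 * ?\<phi> x" using fx by simp
      also have "\<dots> \<le> m * exp (- \<alpha> * ?r x) * 2" using m E0 by (simp add: algebra_simps)
      finally have "4 * \<alpha>\<^sup>2 * ?r x - 2 * ?n * \<alpha> < 2" using m by simp
      moreover have "\<alpha> * (4 * (?n + 1)) \<le> \<alpha> * (4 * (\<alpha> * ?r x))"
      proof -
        have "\<rho>\<^sup>2 \<le> ?r x" using far rho by (intro power_mono) auto
        then have "\<alpha> * \<rho>\<^sup>2 \<le> \<alpha> * ?r x" using \<alpha>1 by simp
        then have "?n + 1 \<le> \<alpha> * ?r x" using \<alpha>2 by linarith
        then show ?thesis using \<alpha>1 by (intro mult_left_mono) auto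
      qed
      moreover have "1 * (2 * ?n + 4) \<le> \<alpha> * (2 * ?n + 4)" using \<alpha>1 by (intro mult_right_mono) auto
      moreover have "?n \<ge> 1" by simp
      ultimately show False by (simp add: power2_eq_square algebra_simps)
    qed
    then have "?f b \<le> 0" using x(3) by simp
    moreover have "\<delta> \<le> ?\<phi> b"
    proof -
      have "?r b \<le> R\<^sup>2" using b by (intro power_mono) auto
      then show ?thesis unfolding \<delta>_def using m \<alpha>1 by (intro mult_left_mono) auto
    qed
    ultimately show "\<delta> \<le> w b" by simp
  qed
qed

text \<open>
  If \<open>v = A (1 - r\<^sup>2 / R\<^sup>2)\<^sup>2\<close> is a strict subsolution for \<open>- u\<close>, so is \<open>v / s\<close> for every \<open>s \<ge> 1\<close>;
  maximising \<open>v / (- u)\<close> makes \<open>v / s\<close> touch \<open>- u\<close> from below.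
\<close>

lemma le_minus_if_negative_on_large_ball:
  fixes u :: "real^'n \<Rightarrow> real"
  assumes u: "axis_derivs u p q" and eq: "\<And>x. (\<Sum>i\<in>UNIV. q i x) = u x ^ 3 - u x"
    and A: "0 < A" "A < 1" and R: "0 < R" "(real CARD('n) + 2)\<^sup>2 \<le> (1 - A\<^sup>2) * R\<^sup>2"
    and neg: "\<And>x. norm (x - z) \<le> R \<Longrightarrow> u x < 0"
  shows "u z \<le> - A"
proof (rule ccontr)
  assume "\<not> u z \<le> - A"
  then have uz: "- u z < A" by simp
  let ?n = "real CARD('n)"
  let ?r = "\<lambda>y. (norm (y - z))\<^sup>2"
  let ?v = "\<lambda>s. A * (1 - s / R\<^sup>2)\<^sup>2"
  let ?f = "\<lambda>y. ?v (?r y) / (- u y)"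
  have neg': "u y < 0" if "y \<in> cball z R" for y
    using that neg[of y] by (auto simp: dist_norm norm_minus_commute)
  have "continuous_on (cball z R) ?f"
    using neg' R by (intro continuous_intros axis_derivsD(1)[OF u]) force+
  then obtain x where x: "x \<in> cball z R" "\<And>y. y \<in> cball z R \<Longrightarrow> ?f y \<le> ?f x" "?f z \<le> ?f x"
    using compact_attains_max[of "cball z R" z ?f] R by auto
  define s where "s = ?f x"
  have uz0: "u z < 0" using neg'[of z] R by simp
  have "1 < ?f z" using uz uz0 A less_divide_eq[of 1 A "- u z"] by simp
  then have s: "s > 1" using x(3) by (simp add: s_def)
  \<comment> \<open>The rescaled amplitude at which the barrier touches \<open>- u\<close> from
    below; it is smaller than \<open>A\<close> because the quotient already exceeds 1 at the
    centre.\<close>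
  define B where "B = A / s"
  have B: "0 < B" "B < A" using s A by (auto simp: B_def field_simps)
  define g where "g = 1 - ?r x / R\<^sup>2"
  have "s = A * g\<^sup>2 / (- u x)" by (simp only: s_def g_def)
  \<comment> \<open>The quotient vanishes on the sphere, so its maximum lies in the open
    ball.\<close>
  then have g0: "g \<noteq> 0" using s by auto
  have rle: "?r x \<le> R\<^sup>2" using x(1) R
    by (intro power_mono) (auto simp: dist_norm norm_minus_commute)
  then have "0 \<le> g" "g \<le> 1" using R by (auto simp: g_def)
  then have g: "0 < g" "g \<le> 1" using g0 by auto
  have xb: "x \<in> ball z R"
  proof (rule ccontr)
    assume "x \<notin> ball z R"
    then have "norm (x - z) = R" using x(1) by (auto simp: dist_norm norm_minus_commute)
    then show False using g0 R by (simp add: g_def)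
  qed
  have le: "u y \<le> - B * (1 - ?r y / R\<^sup>2)\<^sup>2" if "y \<in> cball z R" for y
  proof -
    have "?f y \<le> s" using x(2)[OF that] by (simp add: s_def)
    then have "?v (?r y) \<le> s * (- u y)"
      using neg'[OF that] pos_divide_le_eq[of "- u y" "?v (?r y)" s] by simp
    then show ?thesis unfolding B_def using s by (simp add: field_simps)
  qed
  have ux: "u x = - B * g\<^sup>2"
  proof -
    have "?v (?r x) = s * (- u x)" using neg'[OF x(1)] by (simp add: s_def)
    then show ?thesis unfolding B_def g_def[symmetric] using s by (simp add: field_simps)
  qed
  have "(\<Sum>i\<in>UNIV. q i x) \<le> 4 * ?r x * (- 2 * B / R^4) + 2 * ?n * (2 * B / R\<^sup>2 * (1 - ?r x / R\<^sup>2))"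
  proof (rule radial_touch[OF u open_ball xb, where F = "\<lambda>s. - B * (1 - s / R\<^sup>2)\<^sup>2"])
    fix y assume "y \<in> ball z R"
    then show "u y - - B * (1 - ?r y / R\<^sup>2)\<^sup>2 \<le> u x - - B * (1 - ?r x / R\<^sup>2)\<^sup>2"
      using le[of y] ux by (simp add: g_def)
  qed (use R in \<open>auto intro!: derivative_eq_intros simp: field_simps eval_nat_numeral\<close>)
  also have "\<dots> = B * (4 * ?n * g - 8 * (1 - g)) / R\<^sup>2"
    using R unfolding g_def by (simp add: field_simps eval_nat_numeral)
  finally have "u x ^ 3 - u x \<le> B * (4 * ?n * g - 8 * (1 - g)) / R\<^sup>2" by (simp add: eq)
  moreover have "u x ^ 3 - u x = B * (g\<^sup>2 * (1 - B\<^sup>2 * g^4))"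
    unfolding ux by (simp add: algebra_simps eval_nat_numeral)
  ultimately have "B * (g\<^sup>2 * (1 - B\<^sup>2 * g^4)) * R\<^sup>2 \<le> B * (4 * ?n * g - 8 * (1 - g))"
    using R by (simp add: field_simps)
  then have "B * (g\<^sup>2 * (1 - B\<^sup>2 * g^4) * R\<^sup>2) \<le> B * (4 * ?n * g - 8 * (1 - g))"
    by (simp add: mult.assoc)
  then have 1: "g\<^sup>2 * (1 - B\<^sup>2 * g^4) * R\<^sup>2 \<le> 4 * ?n * g - 8 * (1 - g)"
    using B by simp
  have "B\<^sup>2 * g^4 \<le> A\<^sup>2 * 1"
    using B g by (intro mult_mono power_mono power_le_one) auto
  then have "(1 - A\<^sup>2) * R\<^sup>2 \<le> (1 - B\<^sup>2 * g^4) * R\<^sup>2" by (intro mult_right_mono) auto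
  then have "(?n + 2)\<^sup>2 \<le> (1 - B\<^sup>2 * g^4) * R\<^sup>2" using R by linarith
  then have "g\<^sup>2 * (?n + 2)\<^sup>2 \<le> g\<^sup>2 * ((1 - B\<^sup>2 * g^4) * R\<^sup>2)" by (intro mult_left_mono) auto
  then have "g\<^sup>2 * (?n + 2)\<^sup>2 \<le> 4 * ?n * g - 8 * (1 - g)" using 1 by (simp add: mult.assoc)
  \<comment> \<open>With X = g (n + 2) the previous line says X squared is at most 4X - 8, whereas
    it is at least 4X - 4.\<close>
  moreover have "0 \<le> (g * (?n + 2) - 2)\<^sup>2" by simp
  ultimately show False by (simp add: power2_eq_square algebra_simps)
qed

subsection \<open>Interior derivative estimates\<close>

lemma norm_le_card:
  fixes y :: "real^'n"
  assumes "\<And>i. \<bar>y $ i\<bar> \<le> 1"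
  shows "norm y \<le> real CARD('n)"
proof -
  have "norm y \<le> (\<Sum>i\<in>UNIV. \<bar>y $ i\<bar>)" by (rule norm_le_l1_cart)
  also have "\<dots> \<le> (\<Sum>i\<in>(UNIV::'n set). 1)" using assms by (intro sum_mono)
  finally show ?thesis by simp
qed

text \<open>Reversing axis \<open>k\<close> changes the sign of \<open>p k\<close> only; second
  derivatives keep their sign, so the Laplacian is merely reflected.\<close>

lemma axis_derivs_reflect:
  fixes w :: "real^'n \<Rightarrow> real" and k :: 'n
  assumes w: "axis_derivs w p q"
  defines "\<sigma> \<equiv> \<lambda>y::real^'n. y - (2 * y $ k) *\<^sub>R axis k 1"
  shows "axis_derivs (\<lambda>y. w (\<sigma> y)) (\<lambda>i y. (if i = k then - 1 else 1) * p i (\<sigma> y)) (\<lambda>i y. q i (\<sigma> y))"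
proof -
  have \<sigma>: "\<sigma> (y + t *\<^sub>R axis i 1) = \<sigma> y + ((if i = k then - 1 else 1) * t) *\<^sub>R axis i 1" for y t i
    unfolding \<sigma>_def by (auto simp: vec_eq_iff axis_def)
  have lin: "((\<lambda>t. (if i = k then - 1 else 1) * t) has_real_derivative (if i = k then - 1 else 1)) (at t)"
    for i t by (auto intro!: derivative_eq_intros)
  have "((\<lambda>t. w (\<sigma> (y + t *\<^sub>R axis i 1))) has_real_derivative
      (if i = k then - 1 else 1) * p i (\<sigma> (y + t *\<^sub>R axis i 1))) (at t)" for y i t
    unfolding \<sigma> by (rule DERIV_cong[OF DERIV_chain2[OF axis_derivsD(2)[OF w] lin]]) simp
  moreover have "((\<lambda>t. (if i = k then - 1 else 1) * p i (\<sigma> (y + t *\<^sub>R axis i 1))) has_real_derivative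
      q i (\<sigma> (y + t *\<^sub>R axis i 1))) (at t)" for y i t
    unfolding \<sigma>
    by (rule DERIV_cong[OF DERIV_cmult[OF DERIV_chain2[OF axis_derivsD(3)[OF w] lin]]]) auto
  moreover have "continuous_on UNIV (\<lambda>y. w (\<sigma> y))" unfolding \<sigma>_def
    by (rule continuous_on_compose2[OF axis_derivsD(1)[OF w, of UNIV]]) (auto intro!: continuous_intros)
  ultimately show ?thesis unfolding axis_derivs_def by blast
qed

text \<open>
  The odd part \<open>W\<close> of \<open>w\<close> in the direction \<open>k\<close> vanishes for \<open>y $ k = 0\<close> and is compared, on a half
  cube, with a quadratic \<open>\<psi>\<close> of Laplacian \<open>- N\<close> (Gilbarg--Trudinger, Section 3.4).
\<close>

lemma gradient_upper_bound:
  fixes w :: "real^'n \<Rightarrow> real"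
  assumes w: "axis_derivs w p q"
    and M: "\<And>y. norm (y - x) \<le> real CARD('n) \<Longrightarrow> \<bar>w y\<bar> \<le> M"
    and N: "\<And>y. norm (y - x) \<le> real CARD('n) \<Longrightarrow> \<bar>\<Sum>i\<in>UNIV. q i y\<bar> < N"
  shows "p k x \<le> real CARD('n) * M + N / 2"
proof -
  let ?n = "real CARD('n)"
  define \<sigma> where "\<sigma> = (\<lambda>y::real^'n. y - (2 * y $ k) *\<^sub>R axis k 1)"
  define C where "C = ?n * M + N / 2"
  have M0: "M \<ge> 0" using M[of x] by simp
  have N0: "N > 0" using N[of x] by simp
  have C0: "C \<ge> 0" using M0 N0 by (simp add: C_def)
  define W where "W = (\<lambda>y. (1/2) * (w (x + y) - w (x + \<sigma> y)))"
  define Q where "Q = (\<lambda>i y. (1/2) * (q i (x + y) - q i (x + \<sigma> y)))"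
  obtain P where W: "axis_derivs W P Q"
    using axis_derivs_cmult[OF axis_derivs_diff[OF axis_derivs_translate[OF w]
      axis_derivs_reflect[OF axis_derivs_translate[OF w], where k = k]], of "1/2"]
    unfolding W_def Q_def \<sigma>_def by blast
  \<comment> \<open>The box is the unit cube cut down to nonnegative \<open>k\<close>-th coordinate.
    It and its mirror image lie in the ball of radius n where \<open>M\<close> and \<open>N\<close>
    apply.\<close>
  define a b :: "real^'n" where "a = (\<chi> i. if i = k then 0 else - 1)" and "b = (\<chi> i. 1)"
  have ab: "y \<in> cbox a b \<longleftrightarrow> (\<forall>i. (if i = k then 0 else - 1) \<le> y $ i \<and> y $ i \<le> 1)" for y
    by (simp add: mem_box_cart a_def b_def)
  have \<sigma>i: "\<bar>\<sigma> y $ i\<bar> = \<bar>y $ i\<bar>" for y i by (auto simp: \<sigma>_def axis_def)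
  have n1: "norm y \<le> ?n" and n2: "norm (\<sigma> y) \<le> ?n" if "y \<in> cbox a b" for y
  proof -
    have "\<bar>y $ i\<bar> \<le> 1" for i using that[unfolded ab, rule_format, of i] by (auto split: if_splits)
    then show "norm y \<le> ?n" "norm (\<sigma> y) \<le> ?n" by (auto intro!: norm_le_card simp: \<sigma>i)
  qed
  have WM: "W y \<le> M" if "y \<in> cbox a b" for y
    using M[of "x + y"] M[of "x + \<sigma> y"] n1[OF that] n2[OF that] by (auto simp: W_def)
  have QN: "- N < (\<Sum>i\<in>UNIV. Q i y)" if "y \<in> cbox a b" for y
    using N[of "x + y"] N[of "x + \<sigma> y"] n1[OF that] n2[OF that]
    by (auto simp: Q_def sum_subtractf sum_divide_distrib[symmetric])
  \<comment> \<open>The constant \<open>C\<close> gives \<psi> the Laplacian 2nM - 2C = -N. On faces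
    where a coordinate has modulus 1 the first term is at least \<open>M\<close>; on the face where
    the \<open>k\<close>-th coordinate is 0, \<open>W\<close> vanishes.\<close>
  let ?\<psi> = "\<lambda>y::real^'n. M * (norm y)\<^sup>2 + C * (y $ k * (1 - y $ k))"
  let ?f = "\<lambda>y. W y - ?\<psi> y"
  have f0: "?f y \<le> 0" if y: "y \<in> cbox a b" for y
  proof -
    have "continuous_on (cbox a b) ?f" by (intro continuous_intros axis_derivsD(1)[OF W])
    then obtain v where v: "v \<in> cbox a b" "\<And>y. y \<in> cbox a b \<Longrightarrow> ?f y \<le> ?f v" "?f y \<le> ?f v"
      using compact_attains_max[of "cbox a b" y ?f] y by auto
    have "?f v \<le> 0"
    proof (rule ccontr)
      assume "\<not> ?f v \<le> 0"
      then have fv: "?f v > 0" by simp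
      have vk: "0 \<le> v $ k" "v $ k \<le> 1" using v(1)[unfolded ab, rule_format, of k] by auto
      then have ck: "0 \<le> C * (v $ k * (1 - v $ k))" using C0 by auto
      have "v $ k \<noteq> 0"
      proof
        assume "v $ k = 0"
        then have "?f v = - M * (norm v)\<^sup>2" by (simp add: W_def \<sigma>_def)
        moreover have "M * (norm v)\<^sup>2 \<ge> 0" using M0 by simp
        ultimately show False using fv by simp
      qed
      have "\<bar>v $ i\<bar> \<noteq> 1" for i
      proof
        assume "\<bar>v $ i\<bar> = 1"
        then have "1 \<le> norm v" using component_le_norm_cart[of v i] by simp
        then have "M * 1 \<le> M * (norm v)\<^sup>2" using M0 by (intro mult_left_mono) auto
        then show False using fv WM[OF v(1)] ck by linarith
      qed
      note v1 = this
      have "a $ i < v $ i \<and> v $ i < b $ i" for i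
        using v(1)[unfolded ab, rule_format, of i] v1[of i] \<open>v $ k \<noteq> 0\<close>
        by (cases "i = k") (auto simp: a_def b_def less_le)
      then have "v \<in> box a b" by (simp add: mem_box_cart)
      then obtain e where e: "0 < e" "ball v e \<subseteq> box a b" using open_box openE by metis
      have line: "v + t *\<^sub>R axis i 1 \<in> cbox a b" if "\<bar>t\<bar> < e" for t and i :: 'n
      proof -
        have "v + t *\<^sub>R axis i 1 \<in> ball v e" using that by (simp add: dist_norm norm_axis_1)
        then show ?thesis using e box_subset_cbox by blast
      qed
      define \<delta> where "\<delta> = (\<lambda>i. if i = k then 1 else 0 :: real)"
      have \<psi>: "?\<psi> (v + t *\<^sub>R axis i 1) = M * ((norm v)\<^sup>2 + 2 * t * v $ i + t\<^sup>2) +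
          C * ((v $ k + t * \<delta> i) * (1 - (v $ k + t * \<delta> i)))" for t i
        unfolding norm_add_axis_sq by (simp add: \<delta>_def axis_def)
      have "Q i v \<le> 2 * M - 2 * C * \<delta> i" for i
      proof (rule axis_touch[OF W e(1), where g = "\<lambda>t. ?\<psi> (v + t *\<^sub>R axis i 1)"
          and g' = "\<lambda>t. M * (2 * v $ i + 2 * t) + C * \<delta> i * (1 - 2 * (v $ k + t * \<delta> i))"])
        fix t :: real
        show "((\<lambda>t. ?\<psi> (v + t *\<^sub>R axis i 1)) has_real_derivative
            M * (2 * v $ i + 2 * t) + C * \<delta> i * (1 - 2 * (v $ k + t * \<delta> i))) (at t)"
          unfolding \<psi> by (auto intro!: derivative_eq_intros simp: algebra_simps)
        show "W (v + t *\<^sub>R axis i 1) - ?\<psi> (v + t *\<^sub>R axis i 1) \<le> W v - ?\<psi> (v + 0 *\<^sub>R axis i 1)"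
          if "\<bar>t\<bar> < e" using v(2)[OF line[OF that, of i]] by simp
      next
        show "((\<lambda>t. M * (2 * v $ i + 2 * t) + C * \<delta> i * (1 - 2 * (v $ k + t * \<delta> i)))
            has_real_derivative 2 * M - 2 * C * \<delta> i) (at 0)"
          by (auto intro!: derivative_eq_intros simp: \<delta>_def)
      qed
      then have "(\<Sum>i\<in>UNIV. Q i v) \<le> (\<Sum>i\<in>UNIV. 2 * M - 2 * C * \<delta> i)" by (rule sum_mono)
      also have "\<dots> = 2 * ?n * M - 2 * C"
        by (simp add: sum_subtractf sum_distrib_left[symmetric] \<delta>_def)
      also have "\<dots> = - N" by (simp add: C_def algebra_simps)
      finally show False using QN[OF v(1)] by simp
    qed
    then show ?thesis using v(3) by linarith
  qed
  have "p k x \<le> C"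
  proof (rule ccontr)
    assume "\<not> p k x \<le> C"
    then have neg: "C - p k x < 0" by simp
    \<comment> \<open>This is \<psi> minus \<open>W\<close> along the positive
      \<open>k\<close>-axis. It vanishes at 0 with slope \<open>C - p k x\<close>, so a negative
      slope would contradict \<open>f0\<close>.\<close>
    let ?G = "\<lambda>t. M * t\<^sup>2 + C * (t * (1 - t)) - (1/2) * (w (x + t *\<^sub>R axis k 1) - w (x + (- t) *\<^sub>R axis k 1))"
    have "((\<lambda>t. w (x + (- t) *\<^sub>R axis k 1)) has_real_derivative p k (x + (- 0) *\<^sub>R axis k 1) * (- 1)) (at 0)"
      by (rule DERIV_chain2[OF axis_derivsD(2)[OF w]]) (auto intro!: derivative_eq_intros)
    moreover have "((\<lambda>t. w (x + t *\<^sub>R axis k 1)) has_real_derivative p k (x + 0 *\<^sub>R axis k 1)) (at 0)"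
      by (rule axis_derivsD(2)[OF w])
    moreover have "((\<lambda>t. M * t\<^sup>2 + C * (t * (1 - t))) has_real_derivative C) (at 0)"
      by (auto intro!: derivative_eq_intros)
    ultimately have "(?G has_real_derivative
        C - (1/2) * (p k (x + 0 *\<^sub>R axis k 1) - p k (x + (- 0) *\<^sub>R axis k 1) * (- 1))) (at 0)"
      by (intro DERIV_diff DERIV_cmult)
    then have "(?G has_real_derivative C - p k x) (at 0)" by simp
    from DERIV_neg_dec_right[OF this neg] obtain d where
      d: "d > 0" "\<And>h. h > 0 \<Longrightarrow> h < d \<Longrightarrow> ?G (0 + h) < ?G 0" by blast
    define h where "h = min (d / 2) 1"
    have h: "0 < h" "h < d" "h \<le> 1" using d(1) by (auto simp: h_def)
    have "?G h < 0" using d(2)[OF h(1,2)] by simp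
    moreover have "h *\<^sub>R axis k 1 \<in> cbox a b" using h by (auto simp: ab axis_def)
    from f0[OF this] have "?G h \<ge> 0"
      by (simp add: W_def \<sigma>_def norm_axis_1 power_mult_distrib flip: scaleR_diff_left)
    ultimately show False by simp
  qed
  then show ?thesis by (simp add: C_def)
qed

lemma gradient_bound:
  fixes w :: "real^'n \<Rightarrow> real"
  assumes w: "axis_derivs w p q"
    and M: "\<And>y. norm (y - x) \<le> real CARD('n) \<Longrightarrow> \<bar>w y\<bar> \<le> M"
    and N: "\<And>y. norm (y - x) \<le> real CARD('n) \<Longrightarrow> \<bar>\<Sum>i\<in>UNIV. q i y\<bar> < N"
  shows "\<bar>p k x\<bar> \<le> real CARD('n) * M + N / 2"
proof -
  have "- p k x \<le> real CARD('n) * M + N / 2"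
    by (rule gradient_upper_bound[OF axis_derivs_uminus[OF w]]) (use M N in \<open>auto simp: sum_negf\<close>)
  moreover have "p k x \<le> real CARD('n) * M + N / 2"
    by (rule gradient_upper_bound[OF w]) (use M N in auto)
  ultimately show ?thesis by simp
qed

lemma axis_difference_quotient:
  fixes f :: "real^'n \<Rightarrow> real"
  assumes f: "\<And>t. ((\<lambda>t. f (y + t *\<^sub>R axis i 1)) has_real_derivative f' (y + t *\<^sub>R axis i 1)) (at t)"
    and h: "0 < h"
  obtains s where "0 < s" "s < h"
    "(1 / h) * (f (h *\<^sub>R axis i 1 + y) - f y) = f' (y + s *\<^sub>R axis i 1)"
proof -
  have "\<exists>s. 0 < s \<and> s < h \<and> f (y + h *\<^sub>R axis i 1) - f (y + 0 *\<^sub>R axis i 1) = (h - 0) * f' (y + s *\<^sub>R axis i 1)"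
    by (rule MVT2) (use h f in auto)
  then show ?thesis using that h by (auto simp: add.commute)
qed

text \<open>Only two derivatives of \<open>w\<close> exist, so the gradient bound is applied to difference quotients.\<close>

lemma second_deriv_bound:
  fixes w :: "real^'n \<Rightarrow> real"
  assumes w: "axis_derivs w p q"
    and r: "((\<lambda>t. p j (x + t *\<^sub>R axis i 1)) has_real_derivative r) (at 0)"
    and A: "\<And>y. norm (y - x) \<le> real CARD('n) + 1 \<Longrightarrow> \<bar>p i y\<bar> \<le> A"
    and G: "\<And>y t. ((\<lambda>t. \<Sum>l\<in>UNIV. q l (y + t *\<^sub>R axis i 1)) has_real_derivative G (y + t *\<^sub>R axis i 1)) (at t)"
    and B: "\<And>y. norm (y - x) \<le> real CARD('n) + 1 \<Longrightarrow> \<bar>G y\<bar> < B"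
  shows "\<bar>r\<bar> \<le> real CARD('n) * A + B / 2"
proof -
  let ?n = "real CARD('n)"
  have bd: "\<bar>(p j (x + h *\<^sub>R axis i 1) - p j (x + 0 *\<^sub>R axis i 1)) / h\<bar> \<le> ?n * A + B / 2"
    if h: "0 < h" "h < 1" for h
  proof -
    \<comment> \<open>The additional 1 in the radius leaves room for the intermediate points of
      difference quotients with step below 1.\<close>
    have near: "norm (y + t *\<^sub>R axis i 1 - x) \<le> ?n + 1"
      if "norm (y - x) \<le> ?n" "0 < t" "t < h" for y t
      using norm_triangle_ineq[of "y - x" "t *\<^sub>R axis i 1"] that h by (simp add: norm_axis_1 algebra_simps)
    \<comment> \<open>By the mean value theorem, bounds on \<open>p i\<close> and on the derivative
      \<open>G\<close> of the Laplacian control the difference quotient and its Laplacian.\<close>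
    note W = axis_derivs_cmult[OF axis_derivs_diff[OF axis_derivs_translate[OF w, where c = "h *\<^sub>R axis i 1"] w], of "1 / h"]
    have "\<bar>(1 / h) * (p j (h *\<^sub>R axis i 1 + x) - p j x)\<bar> \<le> ?n * A + B / 2"
    proof (rule gradient_bound[OF W])
      fix y assume y: "norm (y - x) \<le> ?n"
      show "\<bar>(1 / h) * (w (h *\<^sub>R axis i 1 + y) - w y)\<bar> \<le> A"
        by (rule axis_difference_quotient[OF axis_derivsD(2)[OF w, where x = y and i = i] h(1)])
          (use A near[OF y] in auto)
      show "\<bar>\<Sum>l\<in>UNIV. (1 / h) * (q l (h *\<^sub>R axis i 1 + y) - q l y)\<bar> < B"
        unfolding sum_distrib_left[symmetric] sum_subtractf
        by (rule axis_difference_quotient[OF G[of y] h(1)]) (use B near[OF y] in auto)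
    qed
    then show ?thesis by (simp add: add.commute)
  qed
  have "((\<lambda>h. (p j (x + h *\<^sub>R axis i 1) - p j (x + 0 *\<^sub>R axis i 1)) / h) \<longlongrightarrow> r) (at_right 0)"
    using r unfolding DERIV_def filterlim_at_split by simp
  then have "((\<lambda>h. \<bar>(p j (x + h *\<^sub>R axis i 1) - p j (x + 0 *\<^sub>R axis i 1)) / h\<bar>) \<longlongrightarrow> \<bar>r\<bar>) (at_right 0)"
    by (rule tendsto_rabs)
  then show ?thesis
  proof (rule tendsto_upperbound)
    have "\<forall>\<^sub>F h in at_right (0::real). 0 < h \<and> h < 1" 
      using eventually_at_right_real[of 0 "1::real"] by simp
    then show "\<forall>\<^sub>F h in at_right 0. \<bar>(p j (x + h *\<^sub>R axis i 1) - p j (x + 0 *\<^sub>R axis i 1)) / h\<bar> \<le> ?n * A + B / 2"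
      by eventually_elim (use bd in auto)
  qed simp
qed

subsection \<open>Partial derivatives and the profile\<close>

lemma has_real_derivative_along_axis:
  fixes x :: "real^'n"
  assumes "f differentiable (at (x + t *\<^sub>R axis i 1))"
  shows "((\<lambda>t. f (x + t *\<^sub>R axis i 1)) has_real_derivative partial_deriv i f (x + t *\<^sub>R axis i 1)) (at t)"
proof -
  let ?D = "frechet_derivative f (at (x + t *\<^sub>R axis i 1))"
  have D: "(f has_derivative ?D) (at (x + t *\<^sub>R axis i 1))"
    using assms by (simp add: frechet_derivative_works)
  have "((\<lambda>t. x + t *\<^sub>R axis i 1) has_derivative (\<lambda>s. s *\<^sub>R axis i 1)) (at t)"
    by (auto intro!: derivative_eq_intros)
  from has_derivative_compose[OF this D]
  have "((\<lambda>t. f (x + t *\<^sub>R axis i 1)) has_derivative (\<lambda>s. ?D (s *\<^sub>R axis i 1))) (at t)" .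
  moreover have "(\<lambda>s. ?D (s *\<^sub>R axis i 1)) = (*) (?D (axis i 1))"
    using linear_scale[OF has_derivative_linear[OF D]] by (auto simp: mult.commute)
  ultimately show ?thesis unfolding has_field_derivative_def partial_deriv_def by simp
qed

lemma partial_deriv_translate:
  assumes "f differentiable (at (x + y))"
  shows "partial_deriv i (\<lambda>x. f (x + y)) x = partial_deriv i f (x + y)"
proof -
  have D: "(f has_derivative frechet_derivative f (at (x + y))) (at (x + y))"
    using assms by (simp add: frechet_derivative_works)
  have "((\<lambda>x. x + y) has_derivative (\<lambda>v. v)) (at x)" by (auto intro!: derivative_eq_intros)
  from has_derivative_compose[OF this D] show ?thesis
    unfolding partial_deriv_def by (metis frechet_derivative_at)
qed

lemma C1_differentiable: "C1 f \<Longrightarrow> f differentiable (at x)"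
  unfolding C1_def differentiable_on_def by auto

lemma C2_axis_derivs:
  assumes "C2 f"
  shows "axis_derivs f (\<lambda>i. partial_deriv i f) (\<lambda>i. partial_deriv i (partial_deriv i f))"
  using assms unfolding axis_derivs_def C2_def
  by (auto intro!: has_real_derivative_along_axis C1_differentiable
      differentiable_imp_continuous_on simp: C1_def)

text \<open>Expanding a vector in the standard basis bounds the operator norm of the derivative by n
  times \<open>L\<close>; the mean value inequality does the rest.\<close>

lemma lipschitz_of_partial_deriv_bound:
  fixes f :: "real^'n \<Rightarrow> real"
  assumes f: "\<And>x. f differentiable (at x)" and L: "\<And>i x. \<bar>partial_deriv i f x\<bar> \<le> L"
  shows "\<bar>f x - f y\<bar> \<le> real CARD('n) * L * norm (x - y)"
proof -
  let ?D = "\<lambda>x. frechet_derivative f (at x)"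
  have D: "(f has_derivative ?D x) (at x)" for x
    using f by (simp add: frechet_derivative_works)
  have "onorm (?D x) \<le> real CARD('n) * L" for x
  proof (rule onorm_le)
    fix v :: "real^'n"
    have lin: "linear (?D x)" by (rule has_derivative_linear[OF D])
    have "?D x v = ?D x (\<Sum>i\<in>UNIV. v $ i *\<^sub>R axis i 1)"
      using basis_expansion[of v] by (simp add: scalar_mult_eq_scaleR)
    also have "\<dots> = (\<Sum>i\<in>UNIV. v $ i * partial_deriv i f x)"
      unfolding partial_deriv_def by (simp add: linear_sum[OF lin] linear_scale[OF lin])
    finally have "norm (?D x v) \<le> (\<Sum>i\<in>UNIV. \<bar>v $ i * partial_deriv i f x\<bar>)" by simp
    also have "\<dots> \<le> (\<Sum>i\<in>(UNIV::'n set). norm v * L)"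
      unfolding abs_mult by (intro sum_mono mult_mono component_le_norm_cart L) auto
    finally show "norm (?D x v) \<le> real CARD('n) * L * norm v" by (simp add: mult_ac)
  qed
  then have "norm (f x - f y) \<le> real CARD('n) * L * norm (x - y)"
    by (intro differentiable_bound[of UNIV f ?D]) (auto intro: D)
  then show ?thesis by simp
qed

section \<open>The profile \<open>H\<close> as a solution\<close>

lemma H_deriv: "(H has_real_derivative (1 - (H t)\<^sup>2) / sqrt 2) (at t)"
proof -
  have "((\<lambda>t. t / sqrt 2) has_real_derivative 1 / sqrt 2) (at t)"
    by (rule DERIV_cdivide[OF DERIV_ident])
  from DERIV_chain2[OF has_field_derivative_tanh[OF _ DERIV_ident] this] show ?thesis
    unfolding H_def by simp
qed

lemma H_mono: "s \<le> t \<Longrightarrow> H s \<le> H t"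
  unfolding H_def by (simp add: divide_right_mono)

lemma H_nonneg: "0 \<le> t \<Longrightarrow> 0 \<le> H t"
  unfolding H_def by simp

lemma H_minus: "H (- t) = - H t"
  unfolding H_def by simp

text \<open>The slope of \<open>H\<close> is at most 1, so lowering the shift by \<eta> lowers the
  profile by at most \<eta>.\<close>

lemma H_increment:
  assumes "s \<le> t"
  shows "H t \<le> H s + (t - s)"
proof -
  have "\<exists>y. ((\<lambda>t. t - H t) has_real_derivative y) (at x) \<and> 0 \<le> y" for x
  proof (intro exI conjI)
    show "((\<lambda>t. t - H t) has_real_derivative 1 - (1 - (H x)\<^sup>2) / sqrt 2) (at x)"
      by (intro DERIV_diff DERIV_ident H_deriv)
    have "(1 - (H x)\<^sup>2) / sqrt 2 \<le> 1 / 1" by (rule frac_le) auto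
    then show "0 \<le> 1 - (1 - (H x)\<^sup>2) / sqrt 2" by simp
  qed
  then have "s - H s \<le> t - H t"
    by (rule DERIV_nonneg_imp_nondecreasing[OF assms, of "\<lambda>t. t - H t"])
  then show ?thesis by simp
qed

lemma H_exceeds:
  assumes "c < 1"
  obtains T where "0 < T" "c < H T"
proof -
  have "\<forall>\<^sub>F t in at_top. c < tanh (t::real)"
    using order_tendstoD(1)[OF tanh_real_at_top assms] .
  moreover have "\<forall>\<^sub>F t in at_top. (0::real) < t" by (rule eventually_gt_at_top)
  ultimately have "\<forall>\<^sub>F t in at_top. c < tanh (t::real) \<and> 0 < t" by eventually_elim auto
  then obtain t where "c < tanh (t::real)" "0 < t" by (auto simp: eventually_at_top_linorder)
  then show ?thesis by (intro that[of "t * sqrt 2"]) (auto simp: H_def)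
qed

text \<open>Applied to \<open>H\<close> and then to its derivative, this yields all partial
  derivatives of the profile up to order two.\<close>

lemma component_function_derivs:
  fixes n :: "'n::finite"
  assumes g: "\<And>t. (g has_real_derivative g' t) (at t)" and c: "continuous_on UNIV g'"
  shows "partial_deriv i (\<lambda>x. g (x $ n + a)) = (\<lambda>x. if i = n then g' (x $ n + a) else 0)"
    and "C1 (\<lambda>x. g (x $ n + a))"
proof -
  have D: "((\<lambda>x. g (x $ n + a)) has_derivative (\<lambda>v. g' (x $ n + a) * v $ n)) (at x)" for x :: "real^'n"
  proof -
    have "((\<lambda>x::real^'n. x $ n + a) has_derivative (\<lambda>v. v $ n)) (at x)"
      by (auto intro!: derivative_eq_intros bounded_linear_imp_has_derivative bounded_linear_vec_nth)
    from has_derivative_compose[OF this g[unfolded has_field_derivative_def]] show ?thesis .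
  qed
  have P: "partial_deriv i (\<lambda>x. g (x $ n + a)) = (\<lambda>x. if i = n then g' (x $ n + a) else 0)" for i
    unfolding partial_deriv_def frechet_derivative_at[OF D, symmetric] by (auto simp: axis_def)
  then show "partial_deriv i (\<lambda>x. g (x $ n + a)) = (\<lambda>x. if i = n then g' (x $ n + a) else 0)" .
  have "continuous_on UNIV (\<lambda>x::real^'n. g' (x $ n + a))"
    by (rule continuous_on_compose2[OF c]) (auto intro!: continuous_intros)
  then have "continuous_on UNIV (partial_deriv i (\<lambda>x::real^'n. g (x $ n + a)))" for i
    unfolding P by (cases "i = n") auto
  then show "C1 (\<lambda>x. g (x $ n + a))"
    unfolding C1_def differentiable_on_def differentiable_def using D by auto
qed

text \<open>Differentiating the first-order equation \<open>H' = (1 - H\<^sup>2) / sqrt 2\<close>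
  once more gives \<open>H'' = H\<^sup>3 - H\<close>.\<close>

lemma classical_solution_H: "classical_solution (\<lambda>x. H (x $ n + a))"
proof -
  let ?H1 = "\<lambda>t. (1 - (H t)\<^sup>2) / sqrt 2"
  let ?H2 = "\<lambda>t. H t ^ 3 - H t"
  have Hc: "continuous_on UNIV H"
    by (rule DERIV_continuous_on[of _ _ ?H1]) (use H_deriv in auto)
  have d2: "(?H1 has_real_derivative ?H2 t) (at t)" for t
  proof (rule DERIV_cong)
    show "(?H1 has_real_derivative - (2 * H t * ((1 - (H t)\<^sup>2) / sqrt 2)) / sqrt 2) (at t)"
      by (auto intro!: derivative_eq_intros H_deriv)
    have "sqrt 2 * sqrt 2 = (2::real)" by simp
    then show "- (2 * H t * ((1 - (H t)\<^sup>2) / sqrt 2)) / sqrt 2 = ?H2 t"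
      by (simp add: field_simps eval_nat_numeral)
  qed
  have c1: "continuous_on UNIV ?H1" and c2: "continuous_on UNIV ?H2"
    by (intro continuous_intros Hc; simp)+
  note P1 = component_function_derivs[where g = H and g' = ?H1 and n = n and a = a, OF H_deriv c1]
  note P2 = component_function_derivs[where g = ?H1 and g' = ?H2 and n = n and a = a, OF d2 c2]
  have P0: "C1 (\<lambda>x::real^'a. 0)" "partial_deriv i (\<lambda>x::real^'a. 0) = (\<lambda>x. 0)" for i
    using component_function_derivs[where g = "\<lambda>_. 0" and g' = "\<lambda>_. 0" and n = n] by auto
  have "C2 (\<lambda>x. H (x $ n + a))"
    unfolding C2_def P1(1)
  proof (intro conjI allI)
    show "C1 (\<lambda>x. if i = n then ?H1 (x $ n + a) else 0)" for i
      using P2(2) P0(1) by (cases "i = n") auto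
  qed (rule P1(2))
  moreover have "laplacian (\<lambda>x. H (x $ n + a)) x = ?H2 (x $ n + a)" for x
  proof -
    have "partial_deriv i (\<lambda>x. if i = n then ?H1 (x $ n + a) else 0) x = (if i = n then ?H2 (x $ n + a) else 0)" for i
      using P2(1) P0(2) by (cases "i = n") auto
    then show ?thesis unfolding laplacian_def P1(1) by simp
  qed
  ultimately show ?thesis unfolding classical_solution_def by simp
qed

subsection \<open>Solutions of the Allen--Cahn equation\<close>

lemma classical_solutionD:
  fixes u :: "real^'n \<Rightarrow> real"
  assumes u: "classical_solution u"
  shows "axis_derivs u (\<lambda>i. partial_deriv i u) (\<lambda>i. partial_deriv i (partial_deriv i u))"
    and "(\<Sum>i\<in>UNIV. partial_deriv i (partial_deriv i u) x) = u x ^ 3 - u x"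
    and "u differentiable (at x)" and "partial_deriv i u differentiable (at x)"
proof -
  show "axis_derivs u (\<lambda>i. partial_deriv i u) (\<lambda>i. partial_deriv i (partial_deriv i u))"
    using u by (simp add: classical_solution_def C2_axis_derivs)
  have "- laplacian u x = u x - u x ^ 3" using u by (simp add: classical_solution_def)
  then show "(\<Sum>i\<in>UNIV. partial_deriv i (partial_deriv i u) x) = u x ^ 3 - u x"
    by (simp add: laplacian_def)
  show "u differentiable (at x)" "partial_deriv i u differentiable (at x)"
    using u by (auto simp: classical_solution_def C2_def intro: C1_differentiable)
qed

lemma solution_abs_le_1:
  assumes u: "classical_solution u"
  shows "\<bar>u x\<bar> \<le> 1"
proof -
  have "u x \<le> 1" by (rule le_1_if_laplacian_eq[OF classical_solutionD(1)[OF u] classical_solutionD(2)[OF u]])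
  moreover have "- u x \<le> 1"
    by (rule le_1_if_laplacian_eq[OF axis_derivs_uminus[OF classical_solutionD(1)[OF u]]])
      (simp add: sum_negf classical_solutionD(2)[OF u])
  ultimately show ?thesis by simp
qed

text \<open>As \<open>u\<close> has values in [-1, 1], its Laplacian is bounded by 1; the value 2 in
  the proof supplies the strict inequality that \<open>gradient_bound\<close> asks for.\<close>

lemma solution_gradient_bound:
  fixes u :: "real^'n \<Rightarrow> real"
  assumes u: "classical_solution u"
  shows "\<bar>partial_deriv i u x\<bar> \<le> real CARD('n) + 1"
proof -
  have "\<bar>partial_deriv i u x\<bar> \<le> real CARD('n) * 1 + 2 / 2"
  proof (rule gradient_bound[OF classical_solutionD(1)[OF u]])
    fix y
    show le: "\<bar>u y\<bar> \<le> 1" by (rule solution_abs_le_1[OF u])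
    have "(u y)\<^sup>2 \<le> 1" using le by (simp add: abs_square_le_1)
    then have "\<bar>u y * ((u y)\<^sup>2 - 1)\<bar> \<le> 1 * 1"
      unfolding abs_mult using le by (intro mult_mono) auto
    moreover have "u y ^ 3 - u y = u y * ((u y)\<^sup>2 - 1)"
      by (simp add: algebra_simps eval_nat_numeral)
    ultimately show "\<bar>\<Sum>i\<in>UNIV. partial_deriv i (partial_deriv i u) y\<bar> < 2"
      by (simp add: classical_solutionD(2)[OF u])
  qed
  then show ?thesis by simp
qed

section \<open>Differences of two solutions\<close>

lemma cube_diff_factor: "(s ^ 3 - s) - (t ^ 3 - t) = (s\<^sup>2 + s * t + t\<^sup>2 - 1) * (s - t)" for s t :: real
  by (simp add: algebra_simps eval_nat_numeral)

lemma cube_diff_factor_bound: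
  fixes s t :: real
  assumes "\<bar>s\<bar> \<le> 1" "\<bar>t\<bar> \<le> 1"
  shows "\<bar>s\<^sup>2 + s * t + t\<^sup>2 - 1\<bar> \<le> 2"
proof -
  have "s\<^sup>2 \<le> 1" "t\<^sup>2 \<le> 1" using assms by (auto simp: abs_square_le_1)
  moreover have "\<bar>s * t\<bar> \<le> 1" using assms by (simp add: abs_mult mult_le_one)
  moreover have "0 \<le> (s + t)\<^sup>2" "0 \<le> s\<^sup>2" "0 \<le> t\<^sup>2" by auto
  ultimately show ?thesis unfolding power2_sum by linarith
qed

text \<open>The difference solves a linear equation with coefficient of modulus at most 2. This is
  the factor 2 in \<open>supersolution_growth\<close>.\<close>

lemma solution_diff:
  fixes u h :: "real^'n \<Rightarrow> real"
  assumes u: "classical_solution u" and h: "classical_solution h"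
  shows "axis_derivs (\<lambda>x. h x - u x) (\<lambda>i x. partial_deriv i h x - partial_deriv i u x)
      (\<lambda>i x. partial_deriv i (partial_deriv i h) x - partial_deriv i (partial_deriv i u) x)"
    and "(\<Sum>i\<in>UNIV. partial_deriv i (partial_deriv i h) x - partial_deriv i (partial_deriv i u) x)
      = ((h x)\<^sup>2 + h x * u x + (u x)\<^sup>2 - 1) * (h x - u x)"
    and "\<bar>\<Sum>i\<in>UNIV. partial_deriv i (partial_deriv i h) x - partial_deriv i (partial_deriv i u) x\<bar>
      \<le> 2 * \<bar>h x - u x\<bar>"
proof -
  show "axis_derivs (\<lambda>x. h x - u x) (\<lambda>i x. partial_deriv i h x - partial_deriv i u x)
      (\<lambda>i x. partial_deriv i (partial_deriv i h) x - partial_deriv i (partial_deriv i u) x)"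
    by (rule axis_derivs_diff[OF classical_solutionD(1)[OF h] classical_solutionD(1)[OF u]])
  show eq: "(\<Sum>i\<in>UNIV. partial_deriv i (partial_deriv i h) x - partial_deriv i (partial_deriv i u) x)
      = ((h x)\<^sup>2 + h x * u x + (u x)\<^sup>2 - 1) * (h x - u x)"
    unfolding sum_subtractf classical_solutionD(2)[OF u] classical_solutionD(2)[OF h] by (rule cube_diff_factor)
  show "\<bar>\<Sum>i\<in>UNIV. partial_deriv i (partial_deriv i h) x - partial_deriv i (partial_deriv i u) x\<bar>
      \<le> 2 * \<bar>h x - u x\<bar>"
    unfolding eq abs_mult
    by (intro mult_right_mono cube_diff_factor_bound solution_abs_le_1 u h) simp
qed

text \<open>Interior estimates for \<open>h - u\<close>: the second-derivative bound needs gradients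
  up to distance n + 1, and each of these needs values up to distance n further, hence the radius 2n
  + 1.\<close>

lemma solution_C2_closeness:
  fixes u h :: "real^'n \<Rightarrow> real"
  assumes u: "classical_solution u" and h: "classical_solution h" and \<epsilon>: "0 < \<epsilon>"
    and close: "\<And>x. norm (x - c) \<le> 2 * real CARD('n) + 1 \<Longrightarrow> \<bar>h x - u x\<bar> \<le> \<epsilon>"
  defines "K \<equiv> (real CARD('n) + 2) * (real CARD('n) + 4)"
  shows "\<bar>partial_deriv i h c - partial_deriv i u c\<bar> \<le> K * \<epsilon>"
    and "\<bar>partial_deriv i (partial_deriv j h) c - partial_deriv i (partial_deriv j u) c\<bar> \<le> K * \<epsilon>"
proof -
  let ?n = "real CARD('n)"
  define A where "A = (?n + 2) * \<epsilon>"
  have grad: "\<bar>partial_deriv i h x - partial_deriv i u x\<bar> \<le> A" if x: "norm (x - c) \<le> ?n + 1" for x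
  proof -
    have cl: "\<bar>h y - u y\<bar> \<le> \<epsilon>" if "norm (y - x) \<le> ?n" for y
      using close[of y] norm_triangle_ineq[of "y - x" "x - c"] that x by simp
    have "\<bar>partial_deriv i h x - partial_deriv i u x\<bar> \<le> ?n * \<epsilon> + 3 * \<epsilon> / 2"
    proof (rule gradient_bound[OF solution_diff(1)[OF u h]])
      fix y assume "norm (y - x) \<le> ?n"
      from cl[OF this] show le: "\<bar>h y - u y\<bar> \<le> \<epsilon>" .
      show "\<bar>\<Sum>i\<in>UNIV. partial_deriv i (partial_deriv i h) y - partial_deriv i (partial_deriv i u) y\<bar> < 3 * \<epsilon>"
      proof (rule le_less_trans[OF solution_diff(3)[OF u h]])
        have "2 * \<bar>h y - u y\<bar> \<le> 2 * \<epsilon>" by (rule mult_left_mono[OF le]) simp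
        also have "\<dots> < 3 * \<epsilon>" using \<epsilon> by simp
        finally show "2 * \<bar>h y - u y\<bar> < 3 * \<epsilon>" .
      qed
    qed
    also have "\<dots> \<le> A" using \<epsilon> by (simp add: A_def algebra_simps)
    finally show ?thesis .
  qed
  have "A \<le> K * \<epsilon>"
  proof -
    have "?n + 2 \<le> (?n + 2) * (?n + 4)" by simp
    then show ?thesis unfolding A_def K_def using \<epsilon> by (intro mult_right_mono) auto
  qed
  then show "\<bar>partial_deriv i h c - partial_deriv i u c\<bar> \<le> K * \<epsilon>" using grad[of c] by simp
  \<comment> \<open>By the equation, this is the derivative along axis \<open>i\<close> of the
    Laplacian of \<open>h - u\<close>.\<close>
  let ?G = "\<lambda>y. (3 * (h y)\<^sup>2 - 1) * partial_deriv i h y - (3 * (u y)\<^sup>2 - 1) * partial_deriv i u y"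
  define B where "B = 2 * A + 6 * \<epsilon> * (?n + 1) + \<epsilon>"
  have "\<bar>partial_deriv i (partial_deriv j h) c - partial_deriv i (partial_deriv j u) c\<bar> \<le> ?n * A + B / 2"
  proof (rule second_deriv_bound[OF solution_diff(1)[OF u h], where i = i and j = j and x = c and G = ?G])
    have "((\<lambda>t. partial_deriv j h (c + t *\<^sub>R axis i 1) - partial_deriv j u (c + t *\<^sub>R axis i 1)) has_real_derivative
        partial_deriv i (partial_deriv j h) (c + 0 *\<^sub>R axis i 1) - partial_deriv i (partial_deriv j u) (c + 0 *\<^sub>R axis i 1)) (at 0)"
      by (intro DERIV_diff has_real_derivative_along_axis classical_solutionD(4) u h)
    then show "((\<lambda>t. partial_deriv j h (c + t *\<^sub>R axis i 1) - partial_deriv j u (c + t *\<^sub>R axis i 1)) has_real_derivative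
        partial_deriv i (partial_deriv j h) c - partial_deriv i (partial_deriv j u) c) (at 0)" by simp
  next
    fix y assume y: "norm (y - c) \<le> ?n + 1"
    then show "\<bar>partial_deriv i h y - partial_deriv i u y\<bar> \<le> A" by (rule grad)
    have hy: "\<bar>h y\<bar> \<le> 1" and uy: "\<bar>u y\<bar> \<le> 1" using solution_abs_le_1 u h by auto
    \<comment> \<open>Each summand now carries a small factor, either the difference of the
      gradients or \<open>h - u\<close> itself.\<close>
    have G: "?G y = (3 * (h y)\<^sup>2 - 1) * (partial_deriv i h y - partial_deriv i u y)
        + 3 * (h y - u y) * ((h y + u y) * partial_deriv i u y)"
      by (simp add: algebra_simps power2_eq_square)
    have b1: "\<bar>(3 * (h y)\<^sup>2 - 1) * (partial_deriv i h y - partial_deriv i u y)\<bar> \<le> 2 * A"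
      unfolding abs_mult
    proof (intro mult_mono grad y)
      have "(h y)\<^sup>2 \<le> 1" using hy by (simp add: abs_square_le_1)
      moreover have "0 \<le> (h y)\<^sup>2" by simp
      ultimately show "\<bar>3 * (h y)\<^sup>2 - 1\<bar> \<le> 2" by linarith
    qed auto
    have b2: "\<bar>3 * (h y - u y) * ((h y + u y) * partial_deriv i u y)\<bar> \<le> 3 * \<epsilon> * (2 * (?n + 1))"
      unfolding abs_mult
      by (intro mult_mono solution_gradient_bound[OF u])
        (use close[of y] y hy uy \<epsilon> in \<open>auto simp: abs_mult\<close>)
    have "\<bar>?G y\<bar> \<le> 2 * A + 3 * \<epsilon> * (2 * (?n + 1))"
      unfolding G by (rule order_trans[OF abs_triangle_ineq add_mono[OF b1 b2]])
    also have "\<dots> < B" unfolding B_def using \<epsilon> by (simp add: algebra_simps)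
    finally show "\<bar>?G y\<bar> < B" .
  next
    fix y t
    have "((\<lambda>t. h (y + t *\<^sub>R axis i 1) ^ 3 - h (y + t *\<^sub>R axis i 1) - (u (y + t *\<^sub>R axis i 1) ^ 3 - u (y + t *\<^sub>R axis i 1)))
        has_real_derivative ?G (y + t *\<^sub>R axis i 1)) (at t)"
      by (auto intro!: derivative_eq_intros has_real_derivative_along_axis[OF classical_solutionD(3)[OF h]]
          has_real_derivative_along_axis[OF classical_solutionD(3)[OF u]] simp: algebra_simps)
    then show "((\<lambda>t. \<Sum>l\<in>UNIV. partial_deriv l (partial_deriv l h) (y + t *\<^sub>R axis i 1) -
        partial_deriv l (partial_deriv l u) (y + t *\<^sub>R axis i 1)) has_real_derivative ?G (y + t *\<^sub>R axis i 1)) (at t)"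
      unfolding sum_subtractf classical_solutionD(2)[OF u] classical_solutionD(2)[OF h] .
  qed
  also have "\<dots> \<le> K * \<epsilon>" unfolding A_def B_def K_def using \<epsilon> by (simp add: algebra_simps)
  finally show "\<bar>partial_deriv i (partial_deriv j h) c - partial_deriv i (partial_deriv j u) c\<bar> \<le> K * \<epsilon>" .
qed

text \<open>Where \<open>h < u\<close>, the hypothesis puts both values at or above 3/4, or both at
  or below -3/4. The coefficient for \<open>u - h\<close> is then at least 27/16 - 1 > 1/2, and the
  maximum principle for bounded functions applies without any decay at infinity.\<close>

lemma solution_comparison:
  fixes u h :: "real^'n \<Rightarrow> real"
  assumes u: "classical_solution u" and h: "classical_solution h"
    and stable: "\<And>x. h x < u x \<Longrightarrow> 3/4 \<le> h x \<or> u x \<le> - 3/4"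
  shows "u x \<le> h x"
proof -
  have "u x - h x \<le> 0"
  proof (rule max_principle_bounded[OF solution_diff(1)[OF h u], where K = 2 and c = "1/2"])
    show "u x - h x \<le> 2" for x using solution_abs_le_1[OF u, of x] solution_abs_le_1[OF h, of x] by linarith
    fix x assume pos: "0 < u x - h x"
    then have ab: "(3/4 \<le> \<bar>u x\<bar> \<and> 3/4 \<le> \<bar>h x\<bar>) \<and> 0 \<le> u x * h x"
      using stable[of x] by (auto intro: mult_nonneg_nonneg mult_nonpos_nonpos)
    then have "(3/4)\<^sup>2 \<le> (u x)\<^sup>2" "(3/4)\<^sup>2 \<le> (h x)\<^sup>2"
      by (auto simp: abs_le_square_iff[symmetric])
    moreover have "(3/4) * (3/4) \<le> \<bar>u x\<bar> * \<bar>h x\<bar>"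
      using ab by (intro mult_mono) auto
    ultimately have "1/2 \<le> (u x)\<^sup>2 + u x * h x + (h x)\<^sup>2 - 1"
      using ab unfolding abs_mult[symmetric] by (simp add: power2_eq_square)
    then show "1/2 * (u x - h x) \<le> (\<Sum>i\<in>UNIV. partial_deriv i (partial_deriv i u) x - partial_deriv i (partial_deriv i h) x)"
      unfolding solution_diff(2)[OF h u] using pos by (intro mult_right_mono) auto
  qed simp
  then show ?thesis by simp
qed

text \<open>If the gap is at least \<epsilon> at \<open>a\<close>, the gradient bounds keep it above
  \<epsilon>/2 on a ball of fixed radius, and \<open>supersolution_growth\<close> carries a positive
  lower bound to \<open>b\<close>.\<close>

lemma solution_harnack:
  fixes u h :: "real^'n \<Rightarrow> real"
  assumes u: "classical_solution u" and h: "classical_solution h" and le: "\<And>x. u x \<le> h x"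
    and R: "0 < R" and \<epsilon>: "0 < \<epsilon>"
  shows "\<exists>\<delta>>0. \<forall>a b. norm (b - a) \<le> R \<longrightarrow> h b - u b < \<delta> \<longrightarrow> h a - u a < \<epsilon>"
proof -
  let ?n = "real CARD('n)"
  define L where "L = ?n * (?n + 1)"
  have L: "L > 0" unfolding L_def by (intro mult_pos_pos) (auto simp: add_nonneg_pos)
  \<comment> \<open>Within this distance \<open>h\<close> and \<open>u\<close> each vary by at most
    \<epsilon>/4.\<close>
  define \<rho> where "\<rho> = \<epsilon> / (4 * L)"
  have \<rho>: "0 < \<rho>" using L \<epsilon> by (simp add: \<rho>_def)
  obtain \<delta> where \<delta>: "0 < \<delta>"
    "\<And>(w :: real^'n \<Rightarrow> real) p q a b. axis_derivs w p q \<Longrightarrow> (\<And>x. 0 \<le> w x) \<Longrightarrow>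
       (\<And>x. (\<Sum>i\<in>UNIV. q i x) \<le> 2 * w x) \<Longrightarrow> (\<And>x. norm (x - a) \<le> \<rho> \<Longrightarrow> \<epsilon> / 2 \<le> w x) \<Longrightarrow>
       norm (b - a) \<le> R \<Longrightarrow> \<delta> \<le> w b"
    using supersolution_growth[OF \<rho> R, of "\<epsilon> / 2"] \<epsilon> by auto
  show ?thesis
  proof (intro exI[of _ \<delta>] conjI allI impI \<delta>(1))
    fix a b assume ab: "norm (b - a) \<le> R" "h b - u b < \<delta>"
    show "h a - u a < \<epsilon>"
    proof (rule ccontr)
      assume big: "\<not> h a - u a < \<epsilon>"
      have "\<delta> \<le> h b - u b"
      proof (rule \<delta>(2)[OF solution_diff(1)[OF u h] _ _ _ ab(1)])
        show "0 \<le> h x - u x" for x using le by simp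
        show "(\<Sum>i\<in>UNIV. partial_deriv i (partial_deriv i h) x - partial_deriv i (partial_deriv i u) x)
            \<le> 2 * (h x - u x)" for x
          using solution_diff(3)[OF u h, of x] le[of x] by linarith
        fix x assume x: "norm (x - a) \<le> \<rho>"
        have "L * norm (x - a) \<le> \<epsilon> / 4"
          using mult_left_mono[OF x, of L] L by (simp add: \<rho>_def)
        moreover have "\<bar>h x - h a\<bar> \<le> L * norm (x - a)" "\<bar>u x - u a\<bar> \<le> L * norm (x - a)"
          unfolding L_def
          by (intro lipschitz_of_partial_deriv_bound classical_solutionD(3) solution_gradient_bound u h)+
        ultimately show "\<epsilon> / 2 \<le> h x - u x" using big by linarith
      qed
      then show False using ab(2) by simp
    qed
  qed
qed

section \<open>Sliding the profile\<close>

lemma below_some_profile: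
  fixes u :: "real^'n \<Rightarrow> real"
  assumes u: "classical_solution u" and neg: "\<And>x. x $ n < 0 \<Longrightarrow> u x < 0"
  obtains b where "\<And>x. u x \<le> H (x $ n + b)"
proof -
  obtain T where T: "0 < T" "3/4 < H T" using H_exceeds[of "3/4"] by auto
  \<comment> \<open>For \<open>A\<close> = 3/4 the ball lemma needs 7/16 of \<open>R\<^sup>2\<close>
    to be at least \<open>(n + 2)\<^sup>2\<close>; here it is 7/4 of that.\<close>
  define R where "R = 2 * (real CARD('n) + 2)"
  define b where "b = max T (R + 1)"
  show ?thesis
  proof (rule that, rule solution_comparison[OF u classical_solution_H])
    fix x assume x: "H (x $ n + b) < u x"
    \<comment> \<open>In the closed upper half-space the profile exceeds 3/4; in the middle slab it
      is nonnegative while \<open>u\<close> is negative; below the slab a ball of radius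
      \<open>R\<close> fits into the negative half-space.\<close>
    consider "0 \<le> x $ n" | "x $ n < 0" "- b \<le> x $ n" | "x $ n < - b" by linarith
    then show "3/4 \<le> H (x $ n + b) \<or> u x \<le> - 3/4"
    proof cases
      case 1
      then have "H T \<le> H (x $ n + b)" by (intro H_mono) (auto simp: b_def)
      then show ?thesis using T by simp
    next
      case 2
      then show ?thesis using x neg[of x] H_nonneg[of "x $ n + b"] by simp
    next
      case 3
      have "u x \<le> - (3/4)"
      proof (rule le_minus_if_negative_on_large_ball[OF classical_solutionD(1)[OF u] classical_solutionD(2)[OF u]])
        show "0 < R" by (simp add: R_def add_nonneg_pos)
        show "(real CARD('n) + 2)\<^sup>2 \<le> (1 - (3/4)\<^sup>2) * R\<^sup>2"
          unfolding R_def power_mult_distrib by (simp add: power2_eq_square)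
        fix y assume "norm (y - x) \<le> R"
        then have "y $ n \<le> x $ n + R" using component_le_norm_cart[of "y - x" n] by simp
        then show "u y < 0" using 3 by (intro neg) (auto simp: b_def)
      qed auto
      then show ?thesis by simp
    qed
  qed
qed

text \<open>A uniform gap in the slab pays for a small downward shift there; outside the slab the
  stability condition of \<open>solution_comparison\<close> holds.\<close>

lemma profile_can_be_lowered:
  fixes u :: "real^'n \<Rightarrow> real"
  assumes u: "classical_solution u" and le: "\<And>x. u x \<le> H (x $ n + a)"
    and M: "3/4 \<le> H (M - 1)" and \<epsilon>: "0 < \<epsilon>"
    and gap: "\<And>x. \<bar>x $ n + a\<bar> \<le> M \<Longrightarrow> \<epsilon> \<le> H (x $ n + a) - u x"
  shows "\<exists>a'<a. \<forall>x. u x \<le> H (x $ n + a')"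
proof (intro exI conjI allI)
  \<comment> \<open>The cap at 1 keeps the shifted argument above \<open>M - 1\<close> beyond the
    slab.\<close>
  define \<eta> where "\<eta> = min \<epsilon> 1"
  show "a - \<eta> < a" using \<epsilon> by (simp add: \<eta>_def)
  fix x
  show "u x \<le> H (x $ n + (a - \<eta>))"
  proof (rule solution_comparison[OF u classical_solution_H])
    fix x assume x: "H (x $ n + (a - \<eta>)) < u x"
    consider "\<bar>x $ n + a\<bar> \<le> M" | "M < x $ n + a" | "x $ n + a < - M" by linarith
    then show "3/4 \<le> H (x $ n + (a - \<eta>)) \<or> u x \<le> - 3/4"
    proof cases
      case 1
      have "H (x $ n + a) \<le> H (x $ n + (a - \<eta>)) + \<eta>"
        using H_increment[of "x $ n + (a - \<eta>)" "x $ n + a"] \<epsilon> by (simp add: \<eta>_def)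
      then show ?thesis using gap[OF 1] x by (simp add: \<eta>_def)
    next
      case 2
      then have "H (M - 1) \<le> H (x $ n + (a - \<eta>))" by (intro H_mono) (auto simp: \<eta>_def)
      then show ?thesis using M by simp
    next
      case 3
      then have "H (x $ n + a) \<le> H (- (M - 1))" by (intro H_mono) auto
      then show ?thesis using M le[of x] unfolding H_minus by linarith
    qed
  qed
qed

text \<open>Translations by \<open>y k\<close> leave the profile and its derivatives unchanged, so
  \<open>solution_C2_closeness\<close> near \<open>x + y k\<close> upgrades locally uniform
  closeness to second order.\<close>

lemma converges_C2_locI:
  fixes u :: "real^'n \<Rightarrow> real" and y :: "nat \<Rightarrow> real^'n"
  assumes u: "classical_solution u" and y: "\<And>k. y k $ n = 0"
    and lim: "\<And>R \<epsilon>. 0 < R \<Longrightarrow> 0 < \<epsilon> \<Longrightarrow> \<forall>\<^sub>F k in sequentially. \<forall>x. norm x \<le> R \<longrightarrow> \<bar>H ((x + y k) $ n + a) - u (x + y k)\<bar> \<le> \<epsilon>"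
  shows "converges_C2_loc (\<lambda>k x. u (x + y k)) (\<lambda>x. H (x $ n + a))"
proof -
  let ?h = "\<lambda>x::real^'n. H (x $ n + a)"
  let ?n = "real CARD('n)"
  define K where "K = (?n + 2) * (?n + 4)"
  have K: "K > 0" unfolding K_def by (intro mult_pos_pos) (auto simp: add_nonneg_pos)
  have h: "classical_solution ?h" by (rule classical_solution_H)
  have hy: "?h (x + y k) = ?h x" for x k using y by simp
  have tr: "partial_deriv i (\<lambda>x. f (x + y k)) = (\<lambda>x. partial_deriv i f (x + y k))"
    if "\<And>x. f differentiable (at x)" for f i k
    using that by (auto simp: partial_deriv_translate)
  note tr1 = tr[OF classical_solutionD(3)] and tr2 = tr[OF classical_solutionD(4)]
  have hy1: "partial_deriv i ?h (x + y k) = partial_deriv i ?h x" for i x k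
    using tr1[OF h, where i = i and k = k] unfolding hy by (simp add: fun_eq_iff)
  have hy2: "partial_deriv i (partial_deriv j ?h) (x + y k) = partial_deriv i (partial_deriv j ?h) x" for i j x k
    using tr2[OF h, where k = k] unfolding hy1 by (simp add: fun_eq_iff)
  have ev: "\<forall>\<^sub>F k in sequentially. \<forall>x\<in>S. \<bar>?h x - u (x + y k)\<bar> < e \<and>
      \<bar>partial_deriv i ?h x - partial_deriv i u (x + y k)\<bar> < e \<and>
      \<bar>partial_deriv i (partial_deriv j ?h) x - partial_deriv i (partial_deriv j u) (x + y k)\<bar> < e"
    if S: "compact S" and e: "0 < e" for S e i j
  proof -
    obtain B where B: "0 < B" "\<And>x. x \<in> S \<Longrightarrow> norm x \<le> B"
      using compact_imp_bounded[OF S] bounded_pos by blast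
    define \<epsilon> where "\<epsilon> = e / (K + 1)"
    have \<epsilon>: "0 < \<epsilon>" "K * \<epsilon> < e" "\<epsilon> < e"
      using e K by (auto simp: \<epsilon>_def field_simps)
    have "0 < B + (2 * ?n + 1)" using B by (simp add: add_pos_nonneg)
    from lim[OF this \<epsilon>(1)] show ?thesis
    proof eventually_elim
      case (elim k)
      have cl: "\<bar>?h z - u z\<bar> \<le> \<epsilon>" if "x \<in> S" "norm (z - (x + y k)) \<le> 2 * ?n + 1" for x z
        using elim[rule_format, of "z - y k"] norm_triangle_ineq[of x "z - (x + y k)"] that B(2)[OF that(1)]
        by (simp add: algebra_simps)
      show ?case
      proof (intro ballI conjI)
        fix x assume x: "x \<in> S"
        have "\<bar>?h (x + y k) - u (x + y k)\<bar> \<le> \<epsilon>" using cl[OF x, of "x + y k"] by simp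
        then show "\<bar>?h x - u (x + y k)\<bar> < e" unfolding hy using \<epsilon> by linarith
        note c = solution_C2_closeness[where c = "x + y k", OF u h \<epsilon>(1) cl[OF x], folded K_def, unfolded hy1 hy2]
        show "\<bar>partial_deriv i ?h x - partial_deriv i u (x + y k)\<bar> < e"
          using c(1)[where i = i] \<epsilon> by linarith
        show "\<bar>partial_deriv i (partial_deriv j ?h) x - partial_deriv i (partial_deriv j u) (x + y k)\<bar> < e"
          using c(2)[where i = i and j = j] \<epsilon> by linarith
      qed
    qed
  qed
  show ?thesis
    unfolding converges_C2_loc_def uniform_limit_iff tr1[OF u] tr2[OF u]
  proof (intro allI impI conjI)
    fix S :: "(real^'n) set" and e :: real and i j
    assume "compact S" "0 < e"
    from ev[OF this, of i j] have ev':
      "\<forall>\<^sub>F k in sequentially. \<forall>x\<in>S. dist (u (x + y k)) (?h x) < e \<and>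
        dist (partial_deriv i u (x + y k)) (partial_deriv i ?h x) < e \<and>
        dist (partial_deriv i (partial_deriv j u) (x + y k)) (partial_deriv i (partial_deriv j ?h) x) < e"
      by (simp add: dist_real_def abs_minus_commute)
    from ev' show "\<forall>\<^sub>F k in sequentially. \<forall>x\<in>S. dist (u (x + y k)) (?h x) < e"
      by eventually_elim blast
    from ev' show "\<forall>\<^sub>F k in sequentially. \<forall>x\<in>S. dist (partial_deriv i u (x + y k)) (partial_deriv i ?h x) < e"
      by eventually_elim blast
    from ev' show "\<forall>\<^sub>F k in sequentially. \<forall>x\<in>S. dist (partial_deriv i (partial_deriv j u) (x + y k)) (partial_deriv i (partial_deriv j ?h) x) < e"
      by eventually_elim blast
  qed
qed

theorem theorem3:
  fixes u :: "real ^ 'n \<Rightarrow> real" and n :: 'n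
  assumes "classical_solution u"
    and "\<not> u constant_on UNIV"
    and "\<And>x. x $ n < 0 \<Longrightarrow> u x < 0"
  shows "\<exists>a::real. (\<forall>x. u x \<le> H (x $ n + a)) \<and>
    ((\<forall>x. u x = H (x $ n + a)) \<or>
     ((\<forall>x. u x < H (x $ n + a)) \<and>
      (\<exists>y :: nat \<Rightarrow> real ^ 'n.
         (\<forall>k. y k $ n = 0) \<and>
         filterlim (\<lambda>k. norm (y k)) at_top sequentially \<and>
         converges_C2_loc (\<lambda>k x. u (x + y k)) (\<lambda>x. H (x $ n + a)))))"
proof -
  note u = assms(1)
  define S where "S = {b. \<forall>x. u x \<le> H (x $ n + b)}"
  have "S \<noteq> {}" using below_some_profile[OF u assms(3), of n] unfolding S_def by blast
  \<comment> \<open>Otherwise \<open>u\<close> lies below arbitrarily far lowered profiles and is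
    constantly -1, against the assumption that it is not constant.\<close>
  have "bdd_below S"
  proof (rule ccontr)
    assume "\<not> bdd_below S"
    then have *: "\<exists>c\<in>S. c < b" for b unfolding bdd_below_def not_le[symmetric] by blast
    have all: "u x \<le> H (x $ n + b)" for x b
    proof -
      obtain c where "c \<in> S" "c < b" using *[of b] by blast
      then have "u x \<le> H (x $ n + c)" "H (x $ n + c) \<le> H (x $ n + b)"
        by (auto simp: S_def intro: H_mono)
      then show ?thesis by simp
    qed
    have "u x = - 1" for x
    proof (rule ccontr)
      assume "u x \<noteq> - 1"
      then have "- u x < 1" using solution_abs_le_1[OF u, of x] by linarith
      then obtain T where "0 < T" "- u x < H T" by (rule H_exceeds)
      then show False using all[of x "- T - x $ n"] by (simp add: H_minus)
    qed
    then show False using assms(2) unfolding constant_on_def by auto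
  qed
  define a where "a = Inf S"
  let ?h = "\<lambda>x::real^'n. H (x $ n + a)"
  have h: "classical_solution ?h" by (rule classical_solution_H)
  have low: "a \<le> b" if "\<And>x. u x \<le> H (x $ n + b)" for b
    unfolding a_def using \<open>bdd_below S\<close> that by (intro cInf_lower) (auto simp: S_def)
  \<comment> \<open>The infimum is attained: an admissible shift within \<open>u x - ?h x\<close> of
    \<open>a\<close> would contradict \<open>H_increment\<close>.\<close>
  have le: "u x \<le> ?h x" for x
  proof (rule ccontr)
    assume "\<not> u x \<le> ?h x"
    then have "Inf S < a + (u x - ?h x)" by (simp add: a_def)
    then obtain b where b: "b \<in> S" "b < a + (u x - ?h x)"
      using cInf_lessD[OF \<open>S \<noteq> {}\<close>] by blast
    have "u x \<le> H (x $ n + b)" "a \<le> b" using b low by (auto simp: S_def)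
    then show False using H_increment[of "x $ n + a" "x $ n + b"] b by simp
  qed
  show ?thesis
  proof (cases "\<forall>x. u x < ?h x")
    case False
    then obtain b where "\<not> u b < ?h b" by blast
    then have b: "u b = ?h b" using le[of b] by linarith
    \<comment> \<open>Strong maximum principle via Harnack: the gap is 0 at \<open>b\<close>, which
      would make the gap at \<open>x\<close> smaller than itself.\<close>
    have "u x = ?h x" for x
    proof (rule ccontr)
      assume "u x \<noteq> ?h x"
      then have pos: "0 < ?h x - u x" using le[of x] by simp
      have "0 < norm (b - x) + 1" by (simp add: add_nonneg_pos)
      from solution_harnack[OF u h le this pos] obtain \<delta> where \<delta>: "0 < \<delta>"
        "\<forall>v w. norm (w - v) \<le> norm (b - x) + 1 \<longrightarrow> ?h w - u w < \<delta> \<longrightarrow> ?h v - u v < ?h x - u x"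
        by blast
      have "?h x - u x < ?h x - u x" by (rule \<delta>(2)[rule_format, of b x]) (use b \<delta>(1) in auto)
      then show False by simp
    qed
    then show ?thesis using le by blast
  next
    case strict: True
    obtain T where T: "0 < T" "3/4 < H T" using H_exceeds[of "3/4"] by auto
    define M where "M = T + 1"
    \<comment> \<open>Minimality of \<open>a\<close> excludes a uniform gap in the slab.\<close>
    have ex: "\<exists>x. \<bar>x $ n + a\<bar> \<le> M \<and> ?h x - u x < \<epsilon>" if \<epsilon>: "0 < \<epsilon>" for \<epsilon>
    proof (rule ccontr)
      assume *: "\<not> ?thesis"
      have "\<exists>a'<a. \<forall>x. u x \<le> H (x $ n + a')"
      proof (rule profile_can_be_lowered[OF u le _ \<epsilon>, of M])
        show "3/4 \<le> H (M - 1)" using T by (simp add: M_def)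
        show "\<epsilon> \<le> ?h x - u x" if "\<bar>x $ n + a\<bar> \<le> M" for x
          using * that not_le by blast
      qed
      then obtain a' where "a' < a" "\<And>x. u x \<le> H (x $ n + a')" by blast
      then show False using low[of a'] by simp
    qed
    define X where "X k = (SOME x. \<bar>x $ n + a\<bar> \<le> M \<and> ?h x - u x < 1 / real (Suc k))" for k
    have X: "\<bar>X k $ n + a\<bar> \<le> M \<and> ?h (X k) - u (X k) < 1 / real (Suc k)" for k
      unfolding X_def by (rule someI_ex[OF ex]) simp
    \<comment> \<open>The projection of \<open>X k\<close> onto the hyperplane moves it by a bounded
      distance, since the \<open>X k\<close> stay in the slab.\<close>
    define y where "y k = X k - (X k $ n) *\<^sub>R axis n 1" for k
    have yn: "y k $ n = 0" for k by (simp add: y_def axis_def)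
    have Xy: "norm (X k - y k) \<le> M + \<bar>a\<bar>" for k
    proof -
      have "\<bar>X k $ n\<bar> \<le> M + \<bar>a\<bar>" using X[of k] by linarith
      then show ?thesis by (simp add: y_def norm_axis_1)
    qed
    \<comment> \<open>Harnack spreads the small gap at \<open>X k\<close> over every fixed ball
      around \<open>y k\<close>.\<close>
    have close: "\<forall>\<^sub>F k in sequentially. \<forall>v. norm (v - y k) \<le> R \<longrightarrow> ?h v - u v < \<epsilon>"
      if "0 < R" "0 < \<epsilon>" for R \<epsilon>
    proof -
      have "0 < R + (M + \<bar>a\<bar>)" using that T by (simp add: M_def)
      from solution_harnack[OF u h le this that(2)] obtain \<delta> where \<delta>: "0 < \<delta>"
        "\<forall>v w. norm (w - v) \<le> R + (M + \<bar>a\<bar>) \<longrightarrow> ?h w - u w < \<delta> \<longrightarrow> ?h v - u v < \<epsilon>"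
        by blast
      have "(\<lambda>k. 1 / real (Suc k)) \<longlonglongrightarrow> 0" using LIMSEQ_inverse_real_of_nat by (simp add: inverse_eq_divide)
      from order_tendstoD(2)[OF this \<delta>(1)] show ?thesis
      proof eventually_elim
        case (elim k)
        show ?case
        proof (intro allI impI)
          fix v assume "norm (v - y k) \<le> R"
          then have "norm (X k - v) \<le> R + (M + \<bar>a\<bar>)"
            using Xy[of k] norm_triangle_ineq[of "X k - y k" "y k - v"] by (simp add: norm_minus_commute)
          then show "?h v - u v < \<epsilon>" by (rule \<delta>(2)[rule_format]) (use X[of k] elim in linarith)
        qed
      qed
    qed
    have "filterlim (\<lambda>k. norm (y k)) at_top sequentially"
      unfolding filterlim_at_top_gt[where c = 0]
    proof (intro allI impI)
      fix Z :: real assume Z: "0 < Z"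
      \<comment> \<open>The gap at the origin is a fixed positive number; if \<open>y k\<close>
        stayed within distance \<open>Z\<close> of 0 for large \<open>k\<close>,
        \<open>close\<close> would make it smaller than itself.\<close>
      have "0 < ?h 0 - u 0" using strict[rule_format, of 0] by simp
      from close[OF Z this] show "\<forall>\<^sub>F k in sequentially. Z \<le> norm (y k)"
      proof eventually_elim
        case (elim k)
        show ?case using elim[rule_format, of 0] by (cases "Z \<le> norm (y k)") simp_all
      qed
    qed
    moreover have "converges_C2_loc (\<lambda>k x. u (x + y k)) ?h"
    proof (rule converges_C2_locI[OF u yn])
      fix R \<epsilon> :: real assume "0 < R" "0 < \<epsilon>"
      from close[OF this]
      show "\<forall>\<^sub>F k in sequentially. \<forall>x. norm x \<le> R \<longrightarrow> \<bar>?h (x + y k) - u (x + y k)\<bar> \<le> \<epsilon>"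
      proof eventually_elim
        case (elim k)
        show ?case
        proof (intro allI impI)
          fix x :: "real^'n" assume "norm x \<le> R"
          then have "?h (x + y k) - u (x + y k) < \<epsilon>" using elim[rule_format, of "x + y k"] by simp
          then show "\<bar>?h (x + y k) - u (x + y k)\<bar> \<le> \<epsilon>" using le[of "x + y k"] by linarith
        qed
      qed
    qed
    ultimately show ?thesis using le strict yn by blast
  qed
qed

end
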